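(* Let $q\ge2$, $\Gamma=\{(a,b)\in\{1,\dots,q\}^2 : a\neq b\}$ and $E=\mathcal{P}(\{1,\dots,q\})\times(\mathbb{R}^+)^\Gamma$. Let $v:\Gamma\times\mathcal{P}(\{1,\dots,q\})\to\mathbb{R}^+$ be a proper kernel and define $$\mathcal{H}((\mu,w),p)=\sum_{(a,b)\in\Gamma}v(a,b,\mu)\left[\exp\{p_b-p_a+p_{(a,b)}\}-1\right],\qquad (\mu,w)\in E,\ p\in\mathbb{R}^{q}\times\mathbb{R}^{\Gamma}.$$ Let $H:\mathcal{D}(H)\subseteq C_b(E)\to C_b(E)$ be an operator with domain satisfying $C_c^\infty(E)\subseteq\mathcal{D}(H)\subseteq C_b^1(E)$ and given by $Hf(\mu,w)=\mathcal{H}((\mu,w),\nabla f(\mu,w))$. Then for each $\lambda>0$ and $h\in C_b(E)$ the comparison principle holds for $$f-\lambda Hf=h.$$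
   Context: $\mathbb{R}^+=[0,\infty)$; $\mathcal{P}(\{1,\dots,q\})$ is the simplex of probability measures on $\{1,\dots,q\}$. Proper kernel: $v:\Gamma\times\mathcal{P}(\{1,\dots,q\})\to\mathbb{R}^+$ is a proper kernel if it is continuous and for each $(a,b)\in\Gamma$ the map $\mu\mapsto v(a,b,\mu)$ is either identically zero or satisfies: (a) $v(a,b,\mu)=0$ if $\mu(a)=0$, and $v(a,b,\mu)>0$ for all $\mu$ with $\mu(a)>0$; (b) there is a decomposition $v(a,b,\mu)=v_\dagger(a,b,\mu(a))\,v_\ddagger(a,b,\mu)$ such that $v_\dagger:\Gamma\times[0,1]\to\mathbb{R}^+$ is increasing in its third coordinate and $v_\ddagger:\Gamma\times\mathcal{P}(\{1,\dots,q\})\to\mathbb{R}^+$ is continuous with $\inf_\mu v_\ddagger(a,b,\mu)>0$. Function spaces: $C_b(E)$ is the space of bounded continuous functions. Parametrizing $\mu$ by $(\mu(1),\dots,\mu(q-1))$, $E$ is a subset of $\mathbb{R}^{q-1+|\Gamma|}$ contained in the closure of its interior; $C_b^k(E)$ (resp. $C_b^\infty(E)$) is the set of functions on $E$ having an extension to $\mathbb{R}^{q-1+|\Gamma|}$ with $k$ (resp. all orders of) continuous bounded derivatives, and $C_c^k(E)$, $C_c^\infty(E)$ are the subsets of functions with compact support in $E$. The gradient $\nabla f(\mu,w)$ is written with components $p_a$ (in direction $\mu(a)$) and $p_{(a,b)}$ (in direction $w_{(a,b)}$), computed from any $C^1$ extension of $f$ to a neighbourhood in $\mathbb{R}^q\times\mathbb{R}^\Gamma$;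 $\mathcal{H}$ depends only on the differences $p_b-p_a$ and on the $p_{(a,b)}$, which are determined by $f$ on $E$. Viscosity solutions: $u$ is a (viscosity) subsolution of $f-\lambda Hf=h$ if $u$ is bounded, upper semi-continuous and for every $f\in\mathcal{D}(H)$ there is a sequence $x_n\in E$ with $\lim_n u(x_n)-f(x_n)=\sup_x u(x)-f(x)$ and $\lim_n u(x_n)-\lambda Hf(x_n)-h(x_n)\le0$. $v$ is a (viscosity) supersolution if $v$ is bounded, lower semi-continuous and for every $f\in\mathcal{D}(H)$ there is a sequence $x_n\in E$ with $\lim_n v(x_n)-f(x_n)=\inf_x v(x)-f(x)$ and $\lim_n v(x_n)-\lambda Hf(x_n)-h(x_n)\ge0$. The comparison principle holds for the equation if $u\le v$ for every subsolution $u$ and every supersolution $v$. *)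

theory Defs
  imports "HOL-Analysis.Analysis"
begin

section \<open>States, edges and the state space\<close>

text \<open>
  The set of states \<open>{1, \<dots>, q}\<close> with \<open>q \<ge> 2\<close> is the type \<open>'n option\<close> for a nonempty finite
  type \<open>'n\<close> with \<open>q - 1\<close> elements, where \<^const>\<open>None\<close> is the state \<open>q\<close>. Hence every \<open>q \<ge> 2\<close> is
  covered, and \<open>real ^ 'n\<close> is the space of the coordinates \<open>(\<mu>(1), \<dots>, \<mu>(q-1))\<close>.
\<close>

typedef 'n edge = "{e :: 'n option \<times> 'n option. fst e \<noteq> snd e}"
  morphisms ends Edge
  by (rule exI[of _ "(None, Some undefined)"]) simp

instance edge :: (finite) finite
proof
  have "inj (ends :: 'a edge \<Rightarrow> _)"
    by (simp add: inj_on_def ends_inject)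
  then show "finite (UNIV :: 'a edge set)"
    by (rule finite_imageD[rotated]) simp
qed

definition source :: "'n edge \<Rightarrow> 'n option" where
  "source e = fst (ends e)"

definition target :: "'n edge \<Rightarrow> 'n option" where
  "target e = snd (ends e)"

type_synonym 'n weights = "(real, 'n option) vec"
type_synonym 'n point = "(real, 'n option) vec \<times> (real, 'n edge) vec"

definition prob_simplex :: "'n::finite weights set" where
  "prob_simplex = {\<mu>. (\<forall>a. 0 \<le> \<mu> $ a) \<and> (\<Sum>a\<in>UNIV. \<mu> $ a) = 1}"

definition state_space :: "'n::finite point set" where
  "state_space = prob_simplex \<times> {w. \<forall>e. 0 \<le> w $ e}"


section \<open>Proper kernels and the Hamiltonian\<close>

text \<open>
  ``Increasing'' in (b) is read in the weak sense. Since the set of edges is discrete and finite,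
  continuity on \<open>\<Gamma> \<times> \<P>\<close> is continuity in the measure for each edge, and the functions of the
  decomposition may be given edge by edge.
\<close>

definition proper_kernel :: "('n::finite edge \<Rightarrow> 'n weights \<Rightarrow> real) \<Rightarrow> bool" where
  "proper_kernel v \<longleftrightarrow>
    (\<forall>e. \<forall>\<mu>\<in>prob_simplex. 0 \<le> v e \<mu>) \<and>
    (\<forall>e. continuous_on prob_simplex (v e)) \<and>
    (\<forall>e. (\<forall>\<mu>\<in>prob_simplex. v e \<mu> = 0) \<or>
      ((\<forall>\<mu>\<in>prob_simplex. (\<mu> $ source e = 0 \<longrightarrow> v e \<mu> = 0) \<and> (\<mu> $ source e > 0 \<longrightarrow> v e \<mu> > 0)) \<and>
       (\<exists>(v1 :: real \<Rightarrow> real) (v2 :: 'n weights \<Rightarrow> real).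
          (\<forall>\<mu>\<in>prob_simplex. v e \<mu> = v1 (\<mu> $ source e) * v2 \<mu>) \<and>
          (\<forall>r\<in>{0..1}. 0 \<le> v1 r) \<and> mono_on {0..1} v1 \<and>
          (\<forall>\<mu>\<in>prob_simplex. 0 \<le> v2 \<mu>) \<and> continuous_on prob_simplex v2 \<and>
          0 < (INF \<mu>\<in>prob_simplex. v2 \<mu>))))"

definition hamiltonian ::
  "('n::finite edge \<Rightarrow> 'n weights \<Rightarrow> real) \<Rightarrow> 'n point \<Rightarrow> 'n point \<Rightarrow> real" where
  "hamiltonian v x p =
    (\<Sum>e\<in>UNIV. v e (fst x) * (exp (fst p $ target e - fst p $ source e + snd p $ e) - 1))"


section \<open>Function spaces\<close>

text \<open>
  A function on \<^term>\<open>state_space\<close> is represented by the total function that is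
  \<^term>\<open>undefined\<close> elsewhere (\<^const>\<open>extensional\<close>).
\<close>

definition C_b :: "('n::finite point \<Rightarrow> real) set" where
  "C_b = {f \<in> extensional state_space.
            continuous_on state_space f \<and> bounded (f ` state_space)}"

text \<open>
  All partial derivatives of \<open>g\<close> of order at most \<open>k\<close> (order \<open>0\<close> being \<open>g\<close> itself) exist, are
  continuous and bounded; for \<open>k \<ge> 1\<close>, \<open>g\<close> is moreover differentiable with gradient \<open>G\<close>.
\<close>

primrec bounded_derivs :: "nat \<Rightarrow> ('a::euclidean_space \<Rightarrow> real) \<Rightarrow> bool" where
  "bounded_derivs 0 g \<longleftrightarrow> continuous_on UNIV g \<and> bounded (range g)"
| "bounded_derivs (Suc k) g \<longleftrightarrow> continuous_on UNIV g \<and> bounded (range g) \<and>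
    (\<exists>G. (\<forall>x. GDERIV g x :> G x) \<and> (\<forall>i\<in>Basis. bounded_derivs k (\<lambda>x. G x \<bullet> i)))"

definition chart :: "'n::finite point \<Rightarrow> (real ^ 'n) \<times> (real, 'n edge) vec" where
  "chart x = (\<chi> i. fst x $ Some i, snd x)"

definition C_b_k :: "nat \<Rightarrow> ('n::finite point \<Rightarrow> real) set" where
  "C_b_k k = {f \<in> extensional state_space.
     \<exists>g. bounded_derivs k g \<and> (\<forall>x\<in>state_space. f x = g (chart x))}"

definition C_b_inf :: "('n::finite point \<Rightarrow> real) set" where
  "C_b_inf = {f \<in> extensional state_space.
     \<exists>g. (\<forall>k. bounded_derivs k g) \<and> (\<forall>x\<in>state_space. f x = g (chart x))}"

definition C_c_inf :: "('n::finite point \<Rightarrow> real) set" where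
  "C_c_inf = {f \<in> C_b_inf. compact (closure {x \<in> state_space. f x \<noteq> 0})}"

text \<open>
  \<open>p\<close> is the gradient at \<open>x\<close> of some extension of \<open>f\<close> that is continuously differentiable on a
  neighbourhood of the state space in \<open>\<real>\<^sup>q \<times> \<real>\<^sup>\<Gamma>\<close>. Such a \<open>p\<close> is not unique, as the
  state space has empty interior there, but \<open>hamiltonian v x p\<close> depends on \<open>f\<close> only (see
  \<open>hamiltonian_gradient_unique\<close> below).
\<close>

definition is_gradient :: "('n::finite point \<Rightarrow> real) \<Rightarrow> 'n point \<Rightarrow> 'n point \<Rightarrow> bool" where
  "is_gradient f x p \<longleftrightarrow>
    (\<exists>U g G. open U \<and> state_space \<subseteq> U \<and> (\<forall>y\<in>state_space. g y = f y) \<and>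
       (\<forall>y\<in>U. GDERIV g y :> G y) \<and> continuous_on U G \<and> p = G x)"


section \<open>Viscosity solutions\<close>

text \<open>
  Here \<open>D\<close> is the domain of the operator \<open>H\<close>, and the equation is
  \<open>f - \<lambda> H f = h\<close> on \<open>E\<close>.
\<close>

definition upper_semicontinuous_on :: "'a::topological_space set \<Rightarrow> ('a \<Rightarrow> real) \<Rightarrow> bool" where
  "upper_semicontinuous_on E u \<longleftrightarrow>
    (\<forall>x\<in>E. \<forall>c>u x. eventually (\<lambda>y. u y < c) (at x within E))"

definition lower_semicontinuous_on :: "'a::topological_space set \<Rightarrow> ('a \<Rightarrow> real) \<Rightarrow> bool" where
  "lower_semicontinuous_on E u \<longleftrightarrow>
    (\<forall>x\<in>E. \<forall>c<u x. eventually (\<lambda>y. c < u y) (at x within E))"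

definition viscosity_subsolution ::
  "'a::topological_space set \<Rightarrow> ('a \<Rightarrow> real) set \<Rightarrow> (('a \<Rightarrow> real) \<Rightarrow> 'a \<Rightarrow> real) \<Rightarrow>
    real \<Rightarrow> ('a \<Rightarrow> real) \<Rightarrow> ('a \<Rightarrow> real) \<Rightarrow> bool" where
  "viscosity_subsolution E D H lam h u \<longleftrightarrow>
    bounded (u ` E) \<and> upper_semicontinuous_on E u \<and>
    (\<forall>f\<in>D. \<exists>x :: nat \<Rightarrow> 'a. (\<forall>n. x n \<in> E) \<and>
       (\<lambda>n. u (x n) - f (x n)) \<longlonglongrightarrow> (SUP y\<in>E. u y - f y) \<and>
       (\<exists>l\<le>0. (\<lambda>n. u (x n) - lam * H f (x n) - h (x n)) \<longlonglongrightarrow> l))"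

definition viscosity_supersolution ::
  "'a::topological_space set \<Rightarrow> ('a \<Rightarrow> real) set \<Rightarrow> (('a \<Rightarrow> real) \<Rightarrow> 'a \<Rightarrow> real) \<Rightarrow>
    real \<Rightarrow> ('a \<Rightarrow> real) \<Rightarrow> ('a \<Rightarrow> real) \<Rightarrow> bool" where
  "viscosity_supersolution E D H lam h u \<longleftrightarrow>
    bounded (u ` E) \<and> lower_semicontinuous_on E u \<and>
    (\<forall>f\<in>D. \<exists>x :: nat \<Rightarrow> 'a. (\<forall>n. x n \<in> E) \<and>
       (\<lambda>n. u (x n) - f (x n)) \<longlonglongrightarrow> (INF y\<in>E. u y - f y) \<and>
       (\<exists>l\<ge>0. (\<lambda>n. u (x n) - lam * H f (x n) - h (x n)) \<longlonglongrightarrow> l))"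

definition comparison_principle ::
  "'a::topological_space set \<Rightarrow> ('a \<Rightarrow> real) set \<Rightarrow> (('a \<Rightarrow> real) \<Rightarrow> 'a \<Rightarrow> real) \<Rightarrow>
    real \<Rightarrow> ('a \<Rightarrow> real) \<Rightarrow> bool" where
  "comparison_principle E D H lam h \<longleftrightarrow>
    (\<forall>u u'. viscosity_subsolution E D H lam h u \<longrightarrow> viscosity_supersolution E D H lam h u' \<longrightarrow>
       (\<forall>x\<in>E. u x \<le> u' x))"


section \<open>The Hamiltonian of a gradient is well defined\<close>

lemma GDERIV_vanishing_on_convex:
  fixes d :: "'a::real_inner \<Rightarrow> real"
  assumes d: "GDERIV d x :> q" and E: "convex E" "x \<in> E" "y \<in> E" and z: "\<And>y. y \<in> E \<Longrightarrow> d y = 0"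
  shows "(y - x) \<bullet> q = 0"
proof -
  let ?\<phi> = "\<lambda>t::real. x + t *\<^sub>R (y - x)"
  have 1: "(?\<phi> has_derivative (\<lambda>t. t *\<^sub>R (y - x))) (at 0 within {0..1})"
    by (auto intro!: derivative_eq_intros)
  have 2: "(d has_derivative (\<lambda>h. h \<bullet> q)) (at (?\<phi> 0))"
    using d by (simp add: gderiv_def)
  have "((\<lambda>t. d (?\<phi> t)) has_derivative (\<lambda>t. (t *\<^sub>R (y - x)) \<bullet> q)) (at 0 within {0..1})"
    using has_derivative_compose[OF 1 2] .
  then have deriv: "((\<lambda>t. d (?\<phi> t)) has_vector_derivative (y - x) \<bullet> q) (at 0 within {0..1})"
    by (simp add: has_vector_derivative_def)
  have "d (?\<phi> t) = 0" if "t \<in> {0..1}" for t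
  proof (rule z)
    have "?\<phi> t = (1 - t) *\<^sub>R x + t *\<^sub>R y"
      by (simp add: algebra_simps)
    then show "?\<phi> t \<in> E"
      using convexD_alt[OF E] that by auto
  qed
  then have "((\<lambda>t. 0) has_vector_derivative (y - x) \<bullet> q) (at (0::real) within {0..1})"
    by (intro has_vector_derivative_transform[OF _ _ deriv]) auto
  moreover have "((\<lambda>t. 0::real) has_vector_derivative 0) (at (0::real) within {0..1})"
    by (rule has_vector_derivative_const)
  ultimately show ?thesis
    using vector_derivative_unique_within[of 0 "{0..1::real}"]
    by (metis at_within_Icc_at_right trivial_limit_at_right_real zero_less_one)
qed

lemma convex_state_space: "convex (state_space :: 'n::finite point set)"
proof -
  have "convex (prob_simplex :: 'n weights set)"
    by (auto simp: convex_def prob_simplex_def sum.distrib simp flip: sum_distrib_left)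
  moreover have "convex {w :: (real, 'n edge) vec. \<forall>e. 0 \<le> w $ e}"
    by (auto simp: convex_def)
  ultimately show ?thesis
    unfolding state_space_def by (rule convex_Times)
qed

lemma hamiltonian_gradient_unique:
  assumes "x \<in> state_space" "is_gradient f x p" "is_gradient f x p'"
  shows "hamiltonian v x p = hamiltonian v x p'"
proof -
  obtain g G where g: "\<forall>y\<in>state_space. g y = f y" "GDERIV g x :> p"
    using assms unfolding is_gradient_def by blast
  obtain g' G' where g': "\<forall>y\<in>state_space. g' y = f y" "GDERIV g' x :> p'"
    using assms unfolding is_gradient_def by blast
  define q where "q = p - p'"
  have "GDERIV (\<lambda>y. g y - g' y) x :> q"
    unfolding q_def by (intro GDERIV_diff g g')
  then have q: "(y - x) \<bullet> q = 0" if "y \<in> state_space" for y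
    by (rule GDERIV_vanishing_on_convex[OF _ convex_state_space]) (use assms g g' that in auto)
  obtain \<mu> w where x: "x = (\<mu>, w)" "\<mu> \<in> prob_simplex" "\<forall>e. 0 \<le> w $ e"
    using assms(1) by (auto simp: state_space_def)
  have q1: "fst q $ a = \<mu> \<bullet> fst q" for a
  proof -
    have "(axis a 1 :: 'a weights) \<in> prob_simplex"
      by (auto simp: prob_simplex_def axis_def)
    then show ?thesis
      using q[of "(axis a 1, w)"] x
      by (simp add: state_space_def inner_prod_def inner_diff_left inner_axis')
  qed
  have q2: "snd q $ e = 0" for e
  proof -
    have "(\<mu>, w + axis e 1) \<in> state_space"
      using x by (auto simp: state_space_def axis_def)
    from q[OF this] show ?thesis
      by (simp add: x inner_prod_def inner_axis')
  qed
  have "fst p $ target e - fst p $ source e + snd p $ e =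
      fst p' $ target e - fst p' $ source e + snd p' $ e" for e
  proof -
    have "fst q $ target e = fst q $ source e" "snd q $ e = 0"
      using q1[of "target e"] q1[of "source e"] q2[of e] by simp_all
    then show ?thesis
      by (simp add: q_def)
  qed
  then show ?thesis
    by (simp add: hamiltonian_def)
qed

lemma is_gradient_exists:
  fixes f :: "'n::finite point \<Rightarrow> real"
  assumes "f \<in> C_b_k 1"
  shows "\<exists>p. is_gradient f x p"
proof -
  obtain g G where fg: "\<forall>x\<in>state_space. f x = g (chart x)" and G: "\<And>y. GDERIV g y :> G y"
    and c: "\<And>i. i \<in> Basis \<Longrightarrow> continuous_on UNIV (\<lambda>y. G y \<bullet> i)"
  proof -
    obtain g where fg: "\<forall>x\<in>state_space. f x = g (chart x)" and "bounded_derivs (Suc 0) g"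
      using assms unfolding C_b_k_def by auto
    then obtain G where "\<forall>y. GDERIV g y :> G y" "\<forall>i\<in>Basis. bounded_derivs 0 (\<lambda>y. G y \<bullet> i)"
      unfolding bounded_derivs.simps(2) by blast
    then show thesis
      using that[OF fg, of G] unfolding bounded_derivs.simps(1) by blast
  qed
  have contG: "continuous_on UNIV G"
    using c by (subst continuous_on_componentwise) auto
  have lin: "linear (chart :: 'n point \<Rightarrow> _)"
    by (intro linearI) (simp_all add: chart_def vec_eq_iff)
  let ?G = "\<lambda>y. adjoint chart (G (chart y))"
  have "GDERIV (\<lambda>y. g (chart y)) y :> ?G y" for y :: "'n point"
  proof -
    have "((\<lambda>y. g (chart y)) has_derivative (\<lambda>h. chart h \<bullet> G (chart y))) (at y)"
      using has_derivative_compose[OF linear_imp_has_derivative[OF lin] G[unfolded gderiv_def]] .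
    then show ?thesis
      unfolding gderiv_def adjoint_works[OF lin] .
  qed
  moreover have "continuous_on UNIV ?G"
  proof -
    have "continuous_on UNIV (chart :: 'n point \<Rightarrow> _)"
      by (rule linear_continuous_on) (use lin linear_conv_bounded_linear in blast)
    moreover have "continuous_on UNIV (adjoint (chart :: 'n point \<Rightarrow> _))"
      by (rule linear_continuous_on) (use adjoint_linear[OF lin] linear_conv_bounded_linear in blast)
    ultimately show ?thesis
      by (intro continuous_on_compose2[OF _ continuous_on_compose2[OF contG _ subset_UNIV] subset_UNIV])
  qed
  ultimately have "is_gradient f x (?G x)"
    unfolding is_gradient_def
    by (intro exI[of _ UNIV] exI[of _ "\<lambda>y. g (chart y)"] exI[of _ ?G] conjI ballI)
      (simp_all only: fg open_UNIV subset_UNIV)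
  then show ?thesis ..
qed

end

theory Submission
  imports Defs
begin

text \<open>
  Suppose that a subsolution \<open>u\<close> exceeds a supersolution \<open>u'\<close> somewhere by \<open>\<theta> > 0\<close>. The proof
  doubles the variables: it maximizes \<open>u x - u' y - penalty \<alpha> \<beta> \<epsilon> x y\<close> over pairs \<open>x = (\<mu>, w)\<close>,
  \<open>y = (\<nu>, z)\<close>. At a maximum the penalty is a test function for \<open>u\<close> in its first and, up to
  sign, for \<open>u'\<close> in its second argument (\<open>doubling_inequalities\<close>). Subtracting the two
  viscosity inequalities bounds \<open>u x - u' y\<close> by a difference of two Hamiltonians plus
  \<open>h x - h y\<close>, and the point is to make this bound smaller than \<open>\<theta> / 2\<close>.

  The kernels of the two Hamiltonians are evaluated at \<open>\<mu>\<close> and \<open>\<nu>\<close>, and the exponentials in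
  front of them are not bounded as \<open>\<alpha>\<close> grows. What saves the argument is an asymmetric penalty
  on the measures: it charges \<open>\<nu>(a) - \<mu>(a)\<close> only where it is positive. (Both measures have mass
  \<open>1\<close>, so this still controls their distance.) Its contribution to the momentum in direction
  \<open>a\<close> is therefore nonpositive, and is nonzero only if \<open>\<mu>(a) < \<nu>(a)\<close>. Hence the exponent on an
  edge with source \<open>a\<close> can be large only if \<open>\<mu>(a) < \<nu>(a)\<close>, and then monotonicity of the first
  factor of a proper kernel gives \<open>v e \<mu> \<le> (1 + \<eta>) v e \<nu>\<close>, so that the difference of the two
  terms is at most a small multiple of the term at \<open>\<nu>\<close>. That term is bounded, because the
  supersolution inequality bounds the second Hamiltonian from above. If \<open>\<mu>(a) \<ge> \<nu>(a)\<close>, the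
  exponent is bounded in terms of \<open>\<beta>\<close> and \<open>\<epsilon>\<close>, and continuity of the kernel suffices. Both
  cases are combined in \<open>exp_flux_difference_le\<close>.

  The parameters are chosen in the order \<open>\<epsilon>\<close>, \<open>\<beta>\<close>, \<open>\<alpha>\<close>. The containment term with factor \<open>\<epsilon>\<close>
  keeps \<open>w\<close> and \<open>z\<close> in a compact set, on which \<open>h\<close> is uniformly continuous; then \<open>\<beta>\<close> brings \<open>w\<close>
  and \<open>z\<close> close enough for \<open>h\<close>; only then \<open>\<alpha>\<close> brings \<open>\<mu>\<close> and \<open>\<nu>\<close> close, relative to the
  exponent bound that depends on \<open>\<beta>\<close>.

  The domain of the operator is only known to contain smooth functions with compact support, so
  the penalty has to be smooth and has to be cut off without changing its gradient at the
  maximum. The function \<open>exp (- 1 / t)\<close>, continued by \<open>0\<close> to \<open>t \<le> 0\<close>, serves both purposes: it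
  is the asymmetric penalty, and, since it lies below its tangent at \<open>1\<close> on the positive axis,
  it also is the cut-off (\<open>compactly_supported_test_function\<close>).
\<close>

section \<open>Continuously differentiable functions\<close>

text \<open>
  The counterpart of \<^const>\<open>bounded_derivs\<close> without boundedness. Affine functions and squares belong
  to this class, so test functions can be assembled from them by sums, products and
  compositions; boundedness is added at the end, from compact support.
\<close>

primrec cont_derivs :: "nat \<Rightarrow> ('a::euclidean_space \<Rightarrow> real) \<Rightarrow> bool" where
  "cont_derivs 0 g \<longleftrightarrow> continuous_on UNIV g"
| "cont_derivs (Suc k) g \<longleftrightarrow>
    (\<exists>G. (\<forall>x. GDERIV g x :> G x) \<and> (\<forall>i\<in>Basis. cont_derivs k (\<lambda>x. G x \<bullet> i)))"

lemma cont_derivs_SucI: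
  assumes "\<And>x. GDERIV g x :> G x" "\<And>i. i \<in> Basis \<Longrightarrow> cont_derivs k (\<lambda>x. G x \<bullet> i)"
  shows "cont_derivs (Suc k) g"
  using assms by auto

lemma cont_derivs_SucE:
  assumes "cont_derivs (Suc k) g"
  obtains G where "\<And>x. GDERIV g x :> G x" "\<And>i. i \<in> Basis \<Longrightarrow> cont_derivs k (\<lambda>x. G x \<bullet> i)"
  using assms by auto

lemma cont_derivs_lower:
  assumes "cont_derivs (Suc k) g"
  shows "cont_derivs k g"
  using assms
proof (induction k arbitrary: g)
  case 0
  then obtain G where "\<And>x. GDERIV g x :> G x"
    by (rule cont_derivs_SucE) blast
  then show ?case
    by (auto simp: gderiv_def continuous_on_eq_continuous_at intro: has_derivative_continuous)
next
  case (Suc k)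
  then obtain G where "\<And>x. GDERIV g x :> G x" "\<And>i. i \<in> Basis \<Longrightarrow> cont_derivs (Suc k) (\<lambda>x. G x \<bullet> i)"
    by (elim cont_derivs_SucE) blast
  then show ?case
    using Suc.IH cont_derivs_SucI by blast
qed

lemma cont_derivs_imp_continuous:
  assumes "cont_derivs k g"
  shows "continuous_on UNIV g"
  using assms by (induction k) (use cont_derivs_lower in auto)

lemma cont_derivs_const [simp]: "cont_derivs k (\<lambda>x. c)"
proof (induction k arbitrary: c)
  case (Suc k)
  then show ?case
    by (intro cont_derivs_SucI[where G = "\<lambda>x. 0"]) (auto simp: GDERIV_const)
qed simp

lemma cont_derivs_add:
  assumes "cont_derivs k f" "cont_derivs k g"
  shows "cont_derivs k (\<lambda>x. f x + g x)"
  using assms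
proof (induction k arbitrary: f g)
  case 0
  then show ?case by (auto intro: continuous_on_add)
next
  case (Suc k)
  obtain F where F: "\<And>x. GDERIV f x :> F x" "\<And>i. i \<in> Basis \<Longrightarrow> cont_derivs k (\<lambda>x. F x \<bullet> i)"
    using Suc.prems(1) by (rule cont_derivs_SucE) blast
  obtain G where G: "\<And>x. GDERIV g x :> G x" "\<And>i. i \<in> Basis \<Longrightarrow> cont_derivs k (\<lambda>x. G x \<bullet> i)"
    using Suc.prems(2) by (rule cont_derivs_SucE) blast
  show ?case
    by (rule cont_derivs_SucI[OF GDERIV_add[OF F(1) G(1)]])
      (simp add: inner_add_left Suc.IH F(2) G(2))
qed

lemma cont_derivs_mult:
  assumes "cont_derivs k f" "cont_derivs k g"
  shows "cont_derivs k (\<lambda>x. f x * g x)"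
  using assms
proof (induction k arbitrary: f g)
  case 0
  then show ?case by (auto intro: continuous_on_mult)
next
  case (Suc k)
  obtain F where F: "\<And>x. GDERIV f x :> F x" "\<And>i. i \<in> Basis \<Longrightarrow> cont_derivs k (\<lambda>x. F x \<bullet> i)"
    using Suc.prems(1) by (rule cont_derivs_SucE) blast
  obtain G where G: "\<And>x. GDERIV g x :> G x" "\<And>i. i \<in> Basis \<Longrightarrow> cont_derivs k (\<lambda>x. G x \<bullet> i)"
    using Suc.prems(2) by (rule cont_derivs_SucE) blast
  show ?case
    by (rule cont_derivs_SucI[OF GDERIV_mult[OF F(1) G(1)]])
      (use Suc.prems cont_derivs_lower in
        \<open>auto simp: inner_add_left intro!: cont_derivs_add Suc.IH F(2) G(2)\<close>)
qed

lemma cont_derivs_sum: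
  assumes "\<And>j. j \<in> J \<Longrightarrow> cont_derivs k (f j)"
  shows "cont_derivs k (\<lambda>x. \<Sum>j\<in>J. f j x)"
proof (cases "finite J")
  case True
  then show ?thesis
    using assms by (induction J) (auto intro!: cont_derivs_add)
qed simp

lemma cont_derivs_inner: "cont_derivs k (\<lambda>x. x \<bullet> b)"
proof (cases k)
  case 0
  then show ?thesis
    by (simp add: continuous_on_inner continuous_on_id continuous_on_const)
next
  case (Suc n)
  have "GDERIV (\<lambda>x. x \<bullet> b) x :> b" for x
    unfolding gderiv_def by (intro bounded_linear_imp_has_derivative bounded_linear_inner_left)
  then show ?thesis
    unfolding Suc by (rule cont_derivs_SucI) simp
qed

lemma cont_derivs_compose_real:
  fixes f :: "real \<Rightarrow> real"
  assumes "cont_derivs k f" "cont_derivs k g"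
  shows "cont_derivs k (\<lambda>x. f (g x))"
  using assms
proof (induction k arbitrary: f g)
  case 0
  then show ?case by (auto intro: continuous_on_compose2)
next
  case (Suc k)
  obtain F where F: "\<And>x. GDERIV f x :> F x" "\<And>i. i \<in> Basis \<Longrightarrow> cont_derivs k (\<lambda>x. F x \<bullet> i)"
    using Suc.prems(1) by (rule cont_derivs_SucE) blast
  obtain G where G: "\<And>x. GDERIV g x :> G x" "\<And>i. i \<in> Basis \<Longrightarrow> cont_derivs k (\<lambda>x. G x \<bullet> i)"
    using Suc.prems(2) by (rule cont_derivs_SucE) blast
  have d: "DERIV f x :> F x" for x
    using F(1)[of x] by (simp add: gderiv_deriv)
  have "cont_derivs k F"
    using F(2) by simp
  then have "cont_derivs k (\<lambda>x. F (g x))"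
    using cont_derivs_lower[OF Suc.prems(2)] by (rule Suc.IH)
  then have "cont_derivs k (\<lambda>x. (F (g x) *\<^sub>R G x) \<bullet> i)" if "i \<in> Basis" for i
    using cont_derivs_mult G(2)[OF that] by simp
  then show ?case
    by (rule cont_derivs_SucI[OF GDERIV_DERIV_compose[OF G(1) d]])
qed

text \<open>
  The gradient of the composition is the adjoint of \<open>L\<close> applied to the gradient of \<open>g\<close>; in
  coordinates this is a fixed linear combination of the partial derivatives of \<open>g\<close>.
\<close>

lemma cont_derivs_compose_affine:
  fixes L :: "'a::euclidean_space \<Rightarrow> 'b::euclidean_space"
  assumes "cont_derivs k g" "linear L"
  shows "cont_derivs k (\<lambda>x. g (c + L x))"
  using assms(1)
proof (induction k arbitrary: g)
  case 0
  have "continuous_on UNIV L"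
    using assms(2) by (simp add: linear_continuous_on linear_conv_bounded_linear)
  then have "continuous_on UNIV (\<lambda>x. c + L x)"
    by (intro continuous_on_add continuous_on_const)
  with 0 show ?case
    using continuous_on_compose2 by (metis cont_derivs.simps(1) subset_UNIV)
next
  case (Suc k)
  obtain G where G: "\<And>x. GDERIV g x :> G x" "\<And>i. i \<in> Basis \<Longrightarrow> cont_derivs k (\<lambda>x. G x \<bullet> i)"
    using Suc.prems(1) by (rule cont_derivs_SucE) blast
  have "GDERIV (\<lambda>x. g (c + L x)) x :> adjoint L (G (c + L x))" for x
  proof -
    have "((\<lambda>x. c + L x) has_derivative L) (at x)"
      using has_derivative_add[OF has_derivative_const linear_imp_has_derivative[OF assms(2)]]
      by simp
    from has_derivative_compose[OF this G(1)[unfolded gderiv_def]] show ?thesis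
      by (simp add: gderiv_def adjoint_works[OF assms(2)])
  qed
  moreover have "cont_derivs k (\<lambda>x. adjoint L (G (c + L x)) \<bullet> i)" for i
  proof -
    have "adjoint L (G (c + L x)) \<bullet> i = (\<Sum>b\<in>Basis. (G (c + L x) \<bullet> b) * (L i \<bullet> b))" for x
      by (metis adjoint_clauses(2) assms(2) euclidean_inner inner_commute)
    then show ?thesis
      by (auto intro!: cont_derivs_sum cont_derivs_mult Suc.IH G(2))
  qed
  ultimately show ?case
    by (rule cont_derivs_SucI)
qed

lemma cont_derivs_ident: "cont_derivs k (\<lambda>x :: real. x)"
  using cont_derivs_inner[of k "1 :: real"] by simp

lemma cont_derivs_diff:
  assumes "cont_derivs k f" "cont_derivs k g"
  shows "cont_derivs k (\<lambda>x. f x - g x)"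
  using cont_derivs_add[OF assms(1) cont_derivs_mult[OF cont_derivs_const[of k "-1"] assms(2)]]
  by simp

lemma cont_derivs_square:
  assumes "cont_derivs k f"
  shows "cont_derivs k (\<lambda>x. (f x)\<^sup>2)"
  using cont_derivs_mult[OF assms assms] by (simp add: power2_eq_square)

lemma GDERIV_unique: "GDERIV f x :> p \<Longrightarrow> GDERIV f x :> q \<Longrightarrow> p = q"
  unfolding gderiv_def by (metis has_derivative_unique vector_eq_ldot)

lemma cont_derivs_norm_square:
  "cont_derivs k (\<lambda>x. (norm (x - c))\<^sup>2)"
proof -
  have "(norm (x - c))\<^sup>2 = (\<Sum>b\<in>Basis. (x \<bullet> b) * (x \<bullet> b)) + ((-2) * (x \<bullet> c) + c \<bullet> c)" for x
    using euclidean_inner[of x x]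
    by (simp add: power2_norm_eq_inner inner_diff_left inner_diff_right inner_commute)
  then show ?thesis
    by (simp only:) (intro cont_derivs_add cont_derivs_sum cont_derivs_mult cont_derivs_inner
        cont_derivs_const)
qed

lemma GDERIV_norm_square: "GDERIV (\<lambda>x. (norm (x - c))\<^sup>2) x :> 2 *\<^sub>R (x - c)"
  unfolding gderiv_def power2_norm_eq_inner
  by (auto intro!: derivative_eq_intros simp: inner_commute)

text \<open>
  All partial derivatives vanish on the open complement of \<open>K\<close> as well, so each of them is
  bounded as a continuous function with compact support.
\<close>

lemma bounded_derivs_if_compact_support:
  assumes "cont_derivs k g" "compact K" "\<And>x. x \<notin> K \<Longrightarrow> g x = 0"
  shows "bounded_derivs k g"
  using assms(1,3)
proof (induction k arbitrary: g)
  have bdd: "continuous_on UNIV g \<and> bounded (range g)"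
    if "cont_derivs k g" "\<And>x. x \<notin> K \<Longrightarrow> g x = 0" for k g
  proof -
    have c: "continuous_on UNIV g"
      using that(1) by (rule cont_derivs_imp_continuous)
    then have "bounded (g ` K)"
      using assms(2) continuous_on_subset compact_continuous_image compact_imp_bounded by blast
    then have "bounded (insert 0 (g ` K))"
      by simp
    moreover have "range g \<subseteq> insert 0 (g ` K)"
      using that(2) by auto
    ultimately show ?thesis
      using c bounded_subset by blast
  qed
  {
    case 0
    then show ?case
      using bdd[of 0 g] by simp
  next
    case (Suc k)
    obtain G where G: "\<And>x. GDERIV g x :> G x" "\<And>i. i \<in> Basis \<Longrightarrow> cont_derivs k (\<lambda>x. G x \<bullet> i)"
      using Suc.prems(1) by (rule cont_derivs_SucE) blast
    have "G x = 0" if "x \<notin> K" for x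
    proof -
      have "((\<lambda>x. 0) has_derivative (\<lambda>h. h \<bullet> G x)) (at x)"
        by (rule has_derivative_transform_within_open[OF G(1)[unfolded gderiv_def], of "- K"])
          (use that Suc.prems(2) assms(2) in \<open>auto simp: compact_imp_closed\<close>)
      then have "(\<lambda>h. h \<bullet> G x) = (\<lambda>h. 0)"
        using has_derivative_const has_derivative_unique by blast
      then show ?thesis
        by (metis inner_eq_zero_iff)
    qed
    then have "bounded_derivs k (\<lambda>x. G x \<bullet> i)" if "i \<in> Basis" for i
      using that by (intro Suc.IH G(2)) auto
    then show ?case
      using bdd[OF Suc.prems] G(1) by auto
  }
qed

text \<open>
  The penalty is a sum of functions of one coordinate each, which reduces its derivatives to
  calculus in one variable.
\<close>

lemma cont_derivs_coordinate_sums: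
  fixes A :: "'n::finite option \<Rightarrow> real \<Rightarrow> real" and B :: "'n edge \<Rightarrow> real \<Rightarrow> real"
  assumes "\<And>a. cont_derivs k (A a)" "\<And>e. cont_derivs k (B e)"
  shows "cont_derivs k (\<lambda>x. (\<Sum>a\<in>UNIV. A a (fst x $ a)) + (\<Sum>e\<in>UNIV. B e (snd x $ e)))"
proof -
  have "cont_derivs k (\<lambda>x :: 'n point. x \<bullet> (axis a 1, 0))" for a
    by (rule cont_derivs_inner)
  then have 1: "cont_derivs k (\<lambda>x :: 'n point. fst x $ a)" for a
    by (simp add: inner_prod_def inner_axis)
  have "cont_derivs k (\<lambda>x :: 'n point. x \<bullet> (0, axis e 1))" for e
    by (rule cont_derivs_inner)
  then have 2: "cont_derivs k (\<lambda>x :: 'n point. snd x $ e)" for e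
    by (simp add: inner_prod_def inner_axis)
  show ?thesis
    by (intro cont_derivs_add cont_derivs_sum cont_derivs_compose_real[OF assms(1) 1]
        cont_derivs_compose_real[OF assms(2) 2])
qed

lemma GDERIV_coordinate_sums:
  fixes A :: "'n::finite option \<Rightarrow> real \<Rightarrow> real" and B :: "'n edge \<Rightarrow> real \<Rightarrow> real"
  assumes "\<And>a. DERIV (A a) (fst x $ a) :> P a" "\<And>e. DERIV (B e) (snd x $ e) :> Q e"
  shows "GDERIV (\<lambda>x. (\<Sum>a\<in>UNIV. A a (fst x $ a)) + (\<Sum>e\<in>UNIV. B e (snd x $ e))) x :>
    (\<chi> a. P a, \<chi> e. Q e)"
proof -
  have 1: "((\<lambda>x. A a (fst x $ a)) has_derivative (\<lambda>h. fst h $ a * P a)) (at x)" for a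
  proof -
    have "((\<lambda>x. fst x $ a) has_derivative (\<lambda>h. fst h $ a)) (at x)"
      by (intro bounded_linear_imp_has_derivative
          bounded_linear_compose[OF bounded_linear_vec_nth bounded_linear_fst])
    from has_derivative_compose[OF this assms(1)[unfolded has_field_derivative_def]]
    show ?thesis
      by (simp add: mult.commute)
  qed
  have 2: "((\<lambda>x. B e (snd x $ e)) has_derivative (\<lambda>h. snd h $ e * Q e)) (at x)" for e
  proof -
    have "((\<lambda>x. snd x $ e) has_derivative (\<lambda>h. snd h $ e)) (at x)"
      by (intro bounded_linear_imp_has_derivative
          bounded_linear_compose[OF bounded_linear_vec_nth bounded_linear_snd])
    from has_derivative_compose[OF this assms(2)[unfolded has_field_derivative_def]]
    show ?thesis
      by (simp add: mult.commute)
  qed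
  have "((\<lambda>x. (\<Sum>a\<in>UNIV. A a (fst x $ a)) + (\<Sum>e\<in>UNIV. B e (snd x $ e))) has_derivative
      (\<lambda>h. (\<Sum>a\<in>UNIV. fst h $ a * P a) + (\<Sum>e\<in>UNIV. snd h $ e * Q e))) (at x)"
    by (intro has_derivative_add has_derivative_sum 1 2)
  then show ?thesis
    by (simp add: gderiv_def inner_prod_def inner_vec_def)
qed


section \<open>The flat function\<close>

text \<open>
  The derivatives of \<open>exp (- 1 / t)\<close> are polynomials in \<open>1 / t\<close> times \<open>exp (- 1 / t)\<close>. Treating
  all functions of this form at once makes smoothness a plain induction.
\<close>

definition flat_poly :: "real poly \<Rightarrow> real \<Rightarrow> real" where
  "flat_poly P t = (if t > 0 then poly P (1 / t) * exp (- 1 / t) else 0)"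

definition flat :: "real \<Rightarrow> real" where
  "flat = flat_poly 1"

definition flat' :: "real \<Rightarrow> real" where
  "flat' t = (if t > 0 then exp (- 1 / t) / t\<^sup>2 else 0)"

text \<open>
  With \<open>s = 1 / t\<close> this is the fact that the exponential function outgrows every polynomial.
\<close>

lemma flat_poly_tendsto_0: "(flat_poly P \<longlongrightarrow> 0) (at_right 0)"
proof -
  have "((\<lambda>s. poly P s / exp s) \<longlongrightarrow> 0) at_top"
  proof -
    have "((\<lambda>s. \<Sum>i\<le>degree P. coeff P i * (s ^ i / exp s)) \<longlongrightarrow> (\<Sum>i\<le>degree P. coeff P i * 0)) at_top"
      by (intro tendsto_intros tendsto_power_div_exp_0)
    moreover have "(\<lambda>s. \<Sum>i\<le>degree P. coeff P i * (s ^ i / exp s)) = (\<lambda>s. poly P s / exp s)"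
      by (simp add: poly_altdef sum_divide_distrib)
    ultimately show ?thesis
      by simp
  qed
  from filterlim_compose[OF this filterlim_inverse_at_top_right]
  have "((\<lambda>t. poly P (inverse t) / exp (inverse t)) \<longlongrightarrow> 0) (at_right 0)" .
  then show ?thesis
    by (rule Lim_transform_eventually)
      (auto simp: eventually_at_filter flat_poly_def exp_minus divide_inverse)
qed

text \<open>
  The polynomial on the right is \<open>s\<^sup>2 (P s - P' s)\<close> in \<open>s = 1 / t\<close>. At \<open>t = 0\<close> the difference
  quotient \<open>flat_poly P h / h\<close> is again of the form \<^const>\<open>flat_poly\<close>, with the polynomial
  multiplied by \<open>s\<close>.
\<close>

lemma DERIV_flat_poly:
  "DERIV (flat_poly P) t :> flat_poly ([:0, 0, 1:] * (P - pderiv P)) t"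
proof (rule linorder_cases[of t 0])
  assume t: "t < 0"
  have "DERIV (\<lambda>t. 0::real) t :> 0"
    by simp
  then have "DERIV (flat_poly P) t :> 0"
    by (rule has_field_derivative_transform_within_open[of _ _ _ "{..<0}"]) (use t in \<open>auto simp: flat_poly_def\<close>)
  then show ?thesis
    using t by (simp add: flat_poly_def)
next
  assume t: "t = 0"
  have "((\<lambda>h. flat_poly P h / h) \<longlongrightarrow> 0) (at_left 0)"
    by (rule Lim_transform_eventually[OF tendsto_const])
      (auto simp: eventually_at_filter flat_poly_def)
  moreover have "((\<lambda>h. flat_poly P h / h) \<longlongrightarrow> 0) (at_right 0)"
    by (rule Lim_transform_eventually[OF flat_poly_tendsto_0[of "pCons 0 P"]])
      (auto simp: eventually_at_filter flat_poly_def)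
  ultimately have "((\<lambda>h. flat_poly P h / h) \<longlongrightarrow> 0) (at 0)"
    by (rule filterlim_split_at)
  then show ?thesis
    unfolding t has_field_derivative_iff by (simp add: flat_poly_def)
next
  assume t: "t > 0"
  have "DERIV (\<lambda>t. poly P (1 / t) * exp (- 1 / t)) t :>
      poly ([:0, 0, 1:] * (P - pderiv P)) (1 / t) * exp (- 1 / t)"
    using t
    by (auto intro!: derivative_eq_intros DERIV_chain'[OF _ poly_DERIV]
        simp: field_simps power2_eq_square)
  then have "DERIV (flat_poly P) t :> poly ([:0, 0, 1:] * (P - pderiv P)) (1 / t) * exp (- 1 / t)"
    by (rule has_field_derivative_transform_within_open[of _ _ _ "{0<..}"]) (use t in \<open>auto simp: flat_poly_def\<close>)
  then show ?thesis
    using t by (simp add: flat_poly_def)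
qed

lemma cont_derivs_flat_poly: "cont_derivs k (flat_poly P)"
proof (induction k arbitrary: P)
  case 0
  show ?case
    using DERIV_flat_poly by (auto simp: continuous_on_eq_continuous_at intro: DERIV_isCont)
next
  case (Suc k)
  then show ?case
    by (intro cont_derivs_SucI[where G = "flat_poly ([:0, 0, 1:] * (P - pderiv P))"])
      (simp_all only: gderiv_deriv DERIV_flat_poly, simp)
qed

lemma cont_derivs_flat: "cont_derivs k flat"
  by (simp add: flat_def cont_derivs_flat_poly)

lemma flat_eq: "flat t = (if t > 0 then exp (- 1 / t) else 0)"
  by (simp add: flat_def flat_poly_def)

lemma DERIV_flat: "DERIV flat t :> flat' t"
  using DERIV_flat_poly[of 1 t]
  by (simp add: flat_def flat_poly_def flat'_def pderiv_1 power2_eq_square split: if_splits)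

lemma flat_nonneg [simp]: "0 \<le> flat t"
  by (simp add: flat_eq)

lemma flat_pos: "0 < t \<Longrightarrow> 0 < flat t"
  by (simp add: flat_eq)

lemma flat'_nonneg [simp]: "0 \<le> flat' t"
  by (simp add: flat'_def)

lemma flat'_nonpos_eq_0: "t \<le> 0 \<Longrightarrow> flat' t = 0"
  by (simp add: flat'_def)

lemma flat_mono: "s \<le> t \<Longrightarrow> flat s \<le> flat t"
  by (auto simp: flat_eq frac_le)

text \<open>
  The line on the right is the tangent at \<open>t = 1\<close>. Taking logarithms, the inequality becomes
  \<open>1 - 1 / t \<le> ln t\<close>, which holds for all \<open>t > 0\<close> and not just where the function is concave.
\<close>

lemma flat_le_tangent: "0 < t \<Longrightarrow> flat t \<le> exp (-1) * t"
proof -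
  assume t: "0 < t"
  have "1 - 1 / t \<le> ln t"
    using ln_le_minus_one[of "1 / t"] t by (simp add: ln_div)
  then have "exp (- 1 / t) \<le> exp (-1 + ln t)"
    by simp
  also have "\<dots> = exp (-1) * t"
    using t by (simp only: exp_add exp_ln)
  finally show ?thesis
    using t by (simp add: flat_eq)
qed


section \<open>Compactly supported test functions\<close>

text \<open>
  The inverse of \<^const>\<open>chart\<close> on the hyperplane of total mass \<open>1\<close>, split into a constant and a
  linear part in order to apply \<open>cont_derivs_compose_affine\<close>.
\<close>

definition unchart_linear :: "(real ^ 'n::finite) \<times> (real, 'n edge) vec \<Rightarrow> 'n point" where
  "unchart_linear c = (\<chi> a. case a of None \<Rightarrow> - (\<Sum>i\<in>UNIV. fst c $ i) | Some i \<Rightarrow> fst c $ i, snd c)"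

definition unchart :: "(real ^ 'n::finite) \<times> (real, 'n edge) vec \<Rightarrow> 'n point" where
  "unchart c = (axis None 1, 0) + unchart_linear c"

lemma linear_unchart_linear: "linear unchart_linear"
  by (rule linearI)
    (auto simp: unchart_linear_def vec_eq_iff sum.distrib sum_distrib_left split: option.split)

lemma linear_chart: "linear chart"
  by (rule linearI) (simp_all add: chart_def vec_eq_iff)

lemma chart_unchart [simp]: "chart (unchart c) = c"
  by (simp add: chart_def unchart_def unchart_linear_def vec_eq_iff axis_def prod_eq_iff)

lemma sum_UNIV_option: "(\<Sum>a\<in>UNIV. f a) = f None + (\<Sum>i\<in>UNIV. f (Some i))"
  for f :: "'n::finite option \<Rightarrow> real"
  by (simp add: UNIV_option_conv sum.reindex)

lemma unchart_chart [simp]: "x \<in> state_space \<Longrightarrow> unchart (chart x) = x"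
  by (auto simp: chart_def unchart_def unchart_linear_def vec_eq_iff axis_def prod_eq_iff
      state_space_def prob_simplex_def sum_UNIV_option split: option.split)

lemma is_gradient_if_cont_derivs:
  fixes g :: "'n::finite point \<Rightarrow> real"
  assumes "cont_derivs (Suc 0) g" "GDERIV g x :> p" "\<And>y. y \<in> state_space \<Longrightarrow> g y = f y"
  shows "is_gradient f x p"
proof -
  obtain G where G: "\<And>x. GDERIV g x :> G x" "\<And>i. i \<in> Basis \<Longrightarrow> cont_derivs 0 (\<lambda>x. G x \<bullet> i)"
    using assms(1) by (rule cont_derivs_SucE) blast
  have "continuous_on UNIV G"
    using G(2) by (subst continuous_on_componentwise) auto
  moreover have "p = G x"
    using GDERIV_unique[OF assms(2) G(1)] .
  ultimately show ?thesis
    using G(1) assms(3) unfolding is_gradient_def by blast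
qed

text \<open>
  A smooth function \<open>F\<close> may be used in a viscosity inequality at \<open>x\<close> even if it is not
  compactly supported: there is a test function with the same gradient at \<open>x\<close> (for \<open>s = 1\<close>)
  whose increment from \<open>x\<close> is at least that of \<open>F\<close> plus a squared distance, up to a cut-off \<open>C\<close>
  that can be chosen larger than the oscillation of the solution. The squared distance makes
  extrema strict. The case \<open>s = - 1\<close> is for supersolutions.

  The function is \<open>cut (G y)\<close> with \<open>G y = F y + (norm (y - x))\<^sup>2\<close>, where \<open>cut\<close> is a rescaled
  reflection of \<^const>\<open>flat\<close>: for \<open>s = 1\<close> it has slope \<open>1\<close> at \<open>F x\<close>, lies above its tangent there as
  long as it is negative, and is \<open>0\<close> from \<open>F x + C\<close> on. As \<open>F\<close> is nonnegative, \<open>G\<close> exceeds this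
  value outside a ball.
\<close>

lemma compactly_supported_test_function:
  fixes F :: "'n::finite point \<Rightarrow> real"
  assumes smooth: "\<And>k. cont_derivs k F" and nonneg: "\<And>y. 0 \<le> F y"
    and grad: "GDERIV F x :> p" and C: "C > 0" and s: "s * s = 1"
  obtains f where "f \<in> C_c_inf" "is_gradient f x (s *\<^sub>R p)"
    "\<And>y. y \<in> state_space \<Longrightarrow> x \<in> state_space \<Longrightarrow>
       min (F y - F x + (norm (y - x))\<^sup>2) C \<le> s * (f y - f x)"
proof
  define G where "G = (\<lambda>y. F y + (norm (y - x))\<^sup>2)"
  define cut where "cut = (\<lambda>r. - (s * C * exp 1) * flat (1 - (r - F x) / C))"
  define T where "T = (\<lambda>y. cut (G y))"
  define f where "f = restrict T state_space"
  have smooth_T: "cont_derivs k T" for k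
  proof -
    have "cont_derivs k G"
      unfolding G_def by (intro cont_derivs_add smooth cont_derivs_norm_square)
    then have "cont_derivs k (\<lambda>y. (1 + F x / C) + (- 1 / C) * G y)"
      by (intro cont_derivs_add cont_derivs_mult cont_derivs_const)
    then have "cont_derivs k (\<lambda>y. - (s * C * exp 1) * flat ((1 + F x / C) + (- 1 / C) * G y))"
      by (intro cont_derivs_mult cont_derivs_const cont_derivs_compose_real[OF cont_derivs_flat])
    then show ?thesis
      by (simp add: T_def cut_def diff_divide_distrib algebra_simps)
  qed
  have supp: "y \<in> cball x (sqrt (F x + C))" if "T y \<noteq> 0" for y
  proof -
    have "1 - (G y - F x) / C > 0"
      using that by (auto simp: T_def cut_def flat_eq split: if_splits)
    then have "G y < F x + C"
      using C by (simp add: field_simps)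
    then have "(norm (y - x))\<^sup>2 \<le> F x + C"
      using nonneg[of y] by (simp add: G_def)
    then show ?thesis
      by (simp add: dist_norm norm_minus_commute real_le_rsqrt)
  qed
  have "bounded_derivs k (\<lambda>c. T (unchart c))" for k
  proof (rule bounded_derivs_if_compact_support)
    show "cont_derivs k (\<lambda>c. T (unchart c))"
      unfolding unchart_def by (rule cont_derivs_compose_affine[OF smooth_T linear_unchart_linear])
    show "compact (chart ` cball x (sqrt (F x + C)))"
      by (intro compact_continuous_image compact_cball linear_continuous_on)
        (simp add: linear_chart linear_linear)
    show "T (unchart c) = 0" if "c \<notin> chart ` cball x (sqrt (F x + C))" for c
      using supp[of "unchart c"] that chart_unchart[of c] by (metis image_eqI)
  qed
  moreover have "f y = T (unchart (chart y))" if "y \<in> state_space" for y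
    using that by (simp add: f_def)
  ultimately have "f \<in> C_b_inf"
    unfolding C_b_inf_def by (auto simp: f_def intro!: exI[of _ "\<lambda>c. T (unchart c)"])
  moreover have "{y \<in> state_space. f y \<noteq> 0} \<subseteq> cball x (sqrt (F x + C))"
    using supp by (auto simp: f_def)
  then have "compact (closure {y \<in> state_space. f y \<noteq> 0})"
    by (meson bounded_cball bounded_subset compact_closure)
  ultimately show "f \<in> C_c_inf"
    by (simp add: C_c_inf_def)
  have "GDERIV G x :> p"
    using GDERIV_add[OF grad GDERIV_norm_square[of x x]] by (simp add: G_def)
  moreover have "DERIV cut (G x) :> s"
  proof -
    have "DERIV cut (G x) :> - (s * C * exp 1) * (flat' (1 - (G x - F x) / C) * (- 1 / C))"
      unfolding cut_def
      by (intro DERIV_cmult DERIV_chain2[OF DERIV_flat])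
        (use C in \<open>auto intro!: derivative_eq_intros\<close>)
    then show ?thesis
      using C by (simp add: G_def flat'_def exp_minus)
  qed
  ultimately have "GDERIV T x :> s *\<^sub>R p"
    unfolding T_def by (rule GDERIV_DERIV_compose)
  then show "is_gradient f x (s *\<^sub>R p)"
    by (rule is_gradient_if_cont_derivs[OF smooth_T]) (simp add: f_def)
  fix y :: "'n point" assume xy: "y \<in> state_space" "x \<in> state_space"
  let ?t = "1 - (G y - F x) / C"
  have "s * (f y - f x) = (s * s) * C * (exp 1 * exp (- 1) - exp 1 * flat ?t)"
    using xy C by (simp add: f_def T_def cut_def G_def flat_eq algebra_simps)
  also have "\<dots> = C - C * (exp 1 * flat ?t)"
    by (simp add: s exp_minus right_diff_distrib)
  finally have eq: "s * (f y - f x) = C - C * (exp 1 * flat ?t)" .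
  show "min (F y - F x + (norm (y - x))\<^sup>2) C \<le> s * (f y - f x)"
  proof (cases "?t > 0")
    case True
    have "exp 1 * flat ?t \<le> exp 1 * (exp (- 1) * ?t)"
      using flat_le_tangent[OF True] by simp
    also have "\<dots> = ?t"
      by (simp add: exp_minus)
    finally have "C * (exp 1 * flat ?t) \<le> C * ?t"
      using C by simp
    also have "C * ?t = C - (G y - F x)"
      using C by (simp add: field_simps)
    finally show ?thesis
      using eq by (simp add: G_def)
  next
    case False
    then show ?thesis
      using eq by (simp add: flat_eq)
  qed
qed


section \<open>Viscosity inequalities at an extremum\<close>

text \<open>
  Viscosity inequalities come with a sequence that is only known to be maximizing; the
  quadratic gap turns it into one that converges to the given maximizer.
\<close>

lemma strict_maximizing_sequence_tendsto:
  fixes x :: "nat \<Rightarrow> 'a::real_normed_vector"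
  assumes gap: "\<And>n. w (x n) + min ((norm (x n - x0))\<^sup>2) 1 \<le> w x0"
    and lim: "(\<lambda>n. w (x n)) \<longlonglongrightarrow> (w x0 :: real)"
  shows "x \<longlonglongrightarrow> x0"
proof -
  have "(\<lambda>n. w x0 - w (x n)) \<longlonglongrightarrow> w x0 - w x0"
    by (intro tendsto_intros lim)
  then have "(\<lambda>n. w x0 - w (x n)) \<longlonglongrightarrow> 0"
    by simp
  moreover have "min ((norm (x n - x0))\<^sup>2) 1 \<le> w x0 - w (x n)" for n
    using gap[of n] by linarith
  ultimately have lim0: "(\<lambda>n. min ((norm (x n - x0))\<^sup>2) 1) \<longlonglongrightarrow> 0"
    using tendsto_sandwich[of "\<lambda>n. 0" "\<lambda>n. min ((norm (x n - x0))\<^sup>2) 1" sequentially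
        "\<lambda>n. w x0 - w (x n)" 0] by simp
  then have "eventually (\<lambda>n. min ((norm (x n - x0))\<^sup>2) 1 < 1) sequentially"
    by (rule order_tendstoD) simp
  then have "eventually (\<lambda>n. min ((norm (x n - x0))\<^sup>2) 1 = (norm (x n - x0))\<^sup>2) sequentially"
    by eventually_elim auto
  then have "(\<lambda>n. (norm (x n - x0))\<^sup>2) \<longlonglongrightarrow> 0"
    by (rule Lim_transform_eventually[OF lim0])
  then have "(\<lambda>n. norm (x n - x0)) \<longlonglongrightarrow> 0"
    using tendsto_real_sqrt[of "\<lambda>n. (norm (x n - x0))\<^sup>2" 0] by simp
  then show ?thesis
    by (simp add: LIM_zero_iff tendsto_norm_zero_iff)
qed

lemma is_gradient_imp_continuous_within:
  assumes "is_gradient f x p" "x \<in> state_space"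
  shows "(f \<longlongrightarrow> f x) (at x within state_space)"
proof -
  obtain g where g: "\<forall>y\<in>state_space. g y = f y" "GDERIV g x :> p"
    using assms unfolding is_gradient_def by blast
  have "isCont g x"
    using g(2) unfolding gderiv_def by (rule has_derivative_continuous)
  then have "(g \<longlongrightarrow> f x) (at x within state_space)"
    using g(1) assms(2) unfolding isCont_def by (metis tendsto_within_subset subset_UNIV)
  then show ?thesis
    by (rule Lim_transform_within[OF _ zero_less_one]) (use g(1) in auto)
qed

locale flux_operator =
  fixes v :: "'n::finite edge \<Rightarrow> 'n weights \<Rightarrow> real"
    and D :: "('n point \<Rightarrow> real) set"
    and H :: "('n point \<Rightarrow> real) \<Rightarrow> ('n point \<Rightarrow> real)"
    and h :: "'n point \<Rightarrow> real"
    and lam :: real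
  assumes kernel: "proper_kernel v"
    and test: "C_c_inf \<subseteq> D"
    and H_cont: "\<And>f. f \<in> D \<Longrightarrow> H f \<in> C_b"
    and H_eq: "\<And>f x p. \<lbrakk>f \<in> D; x \<in> state_space; is_gradient f x p\<rbrakk> \<Longrightarrow> H f x = hamiltonian v x p"
    and lam: "lam > 0" and h: "h \<in> C_b"
begin

text \<open>
  The sequence is the one provided by the definition of a viscosity solution. Although \<open>u\<close> is
  only semicontinuous, it converges along this sequence to its value at \<open>x0\<close>, because \<open>u - f\<close>
  does and \<open>f\<close> is continuous.
\<close>

lemma limit_along_touching_sequence:
  assumes f: "f \<in> D" "is_gradient f x0 p" and x0: "x0 \<in> state_space"
    and x: "\<And>n. x n \<in> state_space" "x \<longlonglongrightarrow> x0"
    and uf: "(\<lambda>n. u (x n) - f (x n)) \<longlonglongrightarrow> u x0 - f x0"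
    and l: "(\<lambda>n. u (x n) - lam * H f (x n) - h (x n)) \<longlonglongrightarrow> l"
  shows "l = u x0 - lam * hamiltonian v x0 p - h x0"
proof -
  have seq: "(\<lambda>n. g (x n)) \<longlonglongrightarrow> g x0" if "(g \<longlongrightarrow> g x0) (at x0 within state_space)" for g :: "'n point \<Rightarrow> real"
    using that x x0 continuous_within_sequentially[of x0 state_space g]
    by (auto simp: continuous_within o_def)
  have cont: "(\<lambda>n. g (x n)) \<longlonglongrightarrow> g x0" if "g \<in> C_b" for g
    using that x0 by (intro seq) (auto simp: C_b_def continuous_on_def)
  have "(\<lambda>n. u (x n) - f (x n) + f (x n)) \<longlonglongrightarrow> u x0 - f x0 + f x0"
    using is_gradient_imp_continuous_within[OF f(2) x0] by (intro tendsto_add uf seq)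
  then have "(\<lambda>n. u (x n)) \<longlonglongrightarrow> u x0"
    by simp
  then have "(\<lambda>n. u (x n) - lam * H f (x n) - h (x n)) \<longlonglongrightarrow> u x0 - lam * H f x0 - h x0"
    by (intro tendsto_diff tendsto_mult tendsto_const cont[OF H_cont[OF f(1)]] cont[OF h])
  from LIMSEQ_unique[OF l this] show ?thesis
    using H_eq[OF f(1) x0 f(2)] by simp
qed

text \<open>
  The classical pointwise form of the viscosity inequality: it holds at the maximizer itself,
  with the gradient of any smooth nonnegative function. Since \<open>\<bar>u\<bar> \<le> M\<close>, the cut-off level
  \<open>2 * M + 1\<close> leaves a gap of at least \<open>1\<close> wherever the test function is cut off.
\<close>

lemma subsolution_at_maximum:
  assumes sub: "viscosity_subsolution state_space D H lam h u"
    and F: "\<And>k. cont_derivs k F" "\<And>y. 0 \<le> F y" "GDERIV F x0 :> p"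
    and x0: "x0 \<in> state_space"
    and max: "\<And>y. y \<in> state_space \<Longrightarrow> u y - F y \<le> u x0 - F x0"
  shows "u x0 - lam * hamiltonian v x0 p - h x0 \<le> 0"
proof -
  obtain M where M: "\<And>y. y \<in> state_space \<Longrightarrow> \<bar>u y\<bar> \<le> M"
    using sub unfolding viscosity_subsolution_def bounded_iff by auto
  then have "M \<ge> 0"
    using x0 abs_ge_zero order_trans by blast
  then obtain f where f: "f \<in> C_c_inf" "is_gradient f x0 p"
    "\<And>y. y \<in> state_space \<Longrightarrow> min (F y - F x0 + (norm (y - x0))\<^sup>2) (2 * M + 1) \<le> f y - f x0"
    using compactly_supported_test_function[OF F, of "2 * M + 1" 1] x0 by auto
  define w where "w = (\<lambda>y. u y - f y)"
  have gap: "w y + min ((norm (y - x0))\<^sup>2) 1 \<le> w x0" if "y \<in> state_space" for y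
    using f(3)[OF that] max[OF that] M[OF that] M[OF x0] by (auto simp: w_def min_def split: if_splits)
  have sup: "(SUP y\<in>state_space. u y - f y) = u x0 - f x0"
  proof (rule cSup_eq_maximum)
    show "z \<le> u x0 - f x0" if "z \<in> (\<lambda>y. u y - f y) ` state_space" for z
      using that gap unfolding w_def by (smt (verit) imageE min_def zero_le_power2)
  qed (use x0 in auto)
  have fD: "f \<in> D"
    using f(1) test by blast
  obtain x l where x: "\<And>n. x n \<in> state_space" and lim: "(\<lambda>n. w (x n)) \<longlonglongrightarrow> w x0"
    and l: "l \<le> 0" "(\<lambda>n. u (x n) - lam * H f (x n) - h (x n)) \<longlonglongrightarrow> l"
    using sub fD unfolding viscosity_subsolution_def sup[symmetric] w_def by blast
  have "x \<longlonglongrightarrow> x0"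
    by (rule strict_maximizing_sequence_tendsto[OF gap[OF x] lim])
  from limit_along_touching_sequence[OF fD f(2) x0 x this lim[unfolded w_def] l(2)]
  show ?thesis
    using l(1) by simp
qed

lemma supersolution_at_minimum:
  assumes super: "viscosity_supersolution state_space D H lam h u"
    and F: "\<And>k. cont_derivs k F" "\<And>y. 0 \<le> F y" "GDERIV F x0 :> p"
    and x0: "x0 \<in> state_space"
    and min: "\<And>y. y \<in> state_space \<Longrightarrow> u x0 + F x0 \<le> u y + F y"
  shows "u x0 - lam * hamiltonian v x0 (- p) - h x0 \<ge> 0"
proof -
  obtain M where M: "\<And>y. y \<in> state_space \<Longrightarrow> \<bar>u y\<bar> \<le> M"
    using super unfolding viscosity_supersolution_def bounded_iff by auto
  then have "M \<ge> 0"
    using x0 abs_ge_zero order_trans by blast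
  then obtain f where f: "f \<in> C_c_inf" "is_gradient f x0 (- p)"
    "\<And>y. y \<in> state_space \<Longrightarrow> min (F y - F x0 + (norm (y - x0))\<^sup>2) (2 * M + 1) \<le> f x0 - f y"
    using compactly_supported_test_function[OF F, of "2 * M + 1" "-1"] x0 by auto
  define w where "w = (\<lambda>y. f y - u y)"
  have gap: "w y + min ((norm (y - x0))\<^sup>2) 1 \<le> w x0" if "y \<in> state_space" for y
    using f(3)[OF that] min[OF that] M[OF that] M[OF x0] by (auto simp: w_def min_def split: if_splits)
  have inf: "(INF y\<in>state_space. u y - f y) = u x0 - f x0"
  proof (rule cInf_eq_minimum)
    show "u x0 - f x0 \<le> z" if "z \<in> (\<lambda>y. u y - f y) ` state_space" for z
      using that gap unfolding w_def by (smt (verit) imageE min_def zero_le_power2)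
  qed (use x0 in auto)
  have fD: "f \<in> D"
    using f(1) test by blast
  obtain x l where x: "\<And>n. x n \<in> state_space"
    and uf: "(\<lambda>n. u (x n) - f (x n)) \<longlonglongrightarrow> u x0 - f x0"
    and l: "l \<ge> 0" "(\<lambda>n. u (x n) - lam * H f (x n) - h (x n)) \<longlonglongrightarrow> l"
    using super fD unfolding viscosity_supersolution_def inf[symmetric] by blast
  have lim: "(\<lambda>n. w (x n)) \<longlonglongrightarrow> w x0"
    using tendsto_minus[OF uf] by (simp add: w_def)
  have "x \<longlonglongrightarrow> x0"
    by (rule strict_maximizing_sequence_tendsto[OF gap[OF x] lim])
  from limit_along_touching_sequence[OF fD f(2) x0 x this uf l(2)]
  show ?thesis
    using l(1) by simp
qed

end


section \<open>Maxima of upper semicontinuous functions\<close>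

lemma upper_semicontinuous_on_add:
  assumes "upper_semicontinuous_on E f" "upper_semicontinuous_on E g"
  shows "upper_semicontinuous_on E (\<lambda>x. f x + g x)"
  unfolding upper_semicontinuous_on_def
proof (intro ballI allI impI)
  fix x c assume x: "x \<in> E" and c: "f x + g x < c"
  define d where "d = (c - f x - g x) / 2"
  have "eventually (\<lambda>y. f y < f x + d) (at x within E)" "eventually (\<lambda>y. g y < g x + d) (at x within E)"
    using assms x c unfolding upper_semicontinuous_on_def by (simp_all add: d_def)
  then show "eventually (\<lambda>y. f y + g y < c) (at x within E)"
    by eventually_elim (simp add: d_def field_simps)
qed

lemma continuous_on_imp_upper_semicontinuous_on:
  "continuous_on E f \<Longrightarrow> upper_semicontinuous_on E f"
  by (auto simp: continuous_on_def upper_semicontinuous_on_def intro: order_tendstoD)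

lemma upper_semicontinuous_on_compose:
  assumes u: "upper_semicontinuous_on A u" and f: "continuous_on E f" "f ` E \<subseteq> A"
  shows "upper_semicontinuous_on E (\<lambda>x. u (f x))"
  unfolding upper_semicontinuous_on_def
proof (intro ballI allI impI)
  fix x c assume x: "x \<in> E" and c: "u (f x) < c"
  have "eventually (\<lambda>y. u y < c) (at (f x) within A)"
    using u x f(2) c unfolding upper_semicontinuous_on_def by blast
  then have "eventually (\<lambda>y. y \<in> A \<longrightarrow> u y < c) (nhds (f x))"
    unfolding eventually_at_filter by eventually_elim (use c in auto)
  then have "eventually (\<lambda>y. f y \<in> A \<longrightarrow> u (f y) < c) (at x within E)"
    using f(1) x unfolding continuous_on_def filterlim_iff by blast
  moreover have "eventually (\<lambda>y. y \<in> E) (at x within E)"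
    by (simp add: eventually_at_filter)
  ultimately show "eventually (\<lambda>y. u (f y) < c) (at x within E)"
    by eventually_elim (use f(2) in auto)
qed

text \<open>
  If every point \<open>x\<close> were beaten by some \<open>b x\<close>, then \<open>b x\<close> would beat a whole neighbourhood of
  \<open>x\<close>; among finitely many of these neighbourhoods covering \<open>K\<close>, the best \<open>b x\<close> would be beaten
  by another one.
\<close>

lemma upper_semicontinuous_on_compact_attains_max:
  assumes u: "upper_semicontinuous_on K u" and K: "compact K" "K \<noteq> {}"
  obtains x where "x \<in> K" "\<And>y. y \<in> K \<Longrightarrow> u y \<le> u x"
proof (rule ccontr)
  assume "\<not> thesis"
  then have "\<forall>x\<in>K. \<exists>y\<in>K. u x < u y"
    using that by (meson not_less)
  then obtain b where b: "\<And>x. x \<in> K \<Longrightarrow> b x \<in> K" "\<And>x. x \<in> K \<Longrightarrow> u x < u (b x)"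
    by metis
  have "\<exists>T. open T \<and> x \<in> T \<and> (\<forall>y\<in>T \<inter> K. u y < u (b x))" if "x \<in> K" for x
  proof -
    have "eventually (\<lambda>y. u y < u (b x)) (at x within K)"
      using u that b(2) unfolding upper_semicontinuous_on_def by blast
    then obtain T where "open T" "x \<in> T" "\<forall>y\<in>T. y \<noteq> x \<longrightarrow> y \<in> K \<longrightarrow> u y < u (b x)"
      unfolding eventually_at_topological by blast
    then show ?thesis
      using b(2)[OF that] by (intro exI[of _ T]) auto
  qed
  then obtain T where T: "\<And>x. x \<in> K \<Longrightarrow> open (T x)" "\<And>x. x \<in> K \<Longrightarrow> x \<in> T x"
    "\<And>x y. x \<in> K \<Longrightarrow> y \<in> T x \<Longrightarrow> y \<in> K \<Longrightarrow> u y < u (b x)"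
    by (metis IntI)
  obtain K' where K': "K' \<subseteq> K" "finite K'" "K \<subseteq> (\<Union>x\<in>K'. T x)"
    using compactE_image[OF K(1), of K T] T by blast
  then have "K' \<noteq> {}"
    using K(2) by auto
  then obtain x where x: "x \<in> K'" "\<And>z. z \<in> K' \<Longrightarrow> u (b z) \<le> u (b x)"
    using arg_min_if_finite(1)[OF K'(2), of "\<lambda>z. - u (b z)"] arg_min_least[OF K'(2), of _ "\<lambda>z. - u (b z)"]
    by (metis neg_le_iff_le)
  obtain z where "z \<in> K'" "b x \<in> T z"
    using b(1) x(1) K'(1,3) by blast
  then show False
    using T(3)[of z "b x"] x b(1) K'(1) by (meson not_less subsetD)
qed


section \<open>The penalty function\<close>

text \<open>
  The first term is asymmetric: it only sees the states that carry less mass under the measure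
  of \<open>x\<close> than under that of \<open>y\<close>. The last term makes the maximization over an unbounded space
  possible.
\<close>

definition penalty :: "real \<Rightarrow> real \<Rightarrow> real \<Rightarrow> 'n::finite point \<Rightarrow> 'n point \<Rightarrow> real" where
  "penalty \<alpha> \<beta> \<epsilon> x y =
    \<alpha> * (\<Sum>a\<in>UNIV. flat (fst y $ a - fst x $ a)) + \<beta> / 2 * (norm (snd x - snd y))\<^sup>2 +
    \<epsilon> / 2 * ((norm (snd x))\<^sup>2 + (norm (snd y))\<^sup>2)"

lemma norm_square_vec: "(norm x)\<^sup>2 = (\<Sum>i\<in>UNIV. (x $ i)\<^sup>2)" for x :: "(real, 'k::finite) vec"
  unfolding power2_norm_eq_inner inner_vec_def by (simp add: power2_eq_square)

lemma penalty_nonneg: "0 \<le> \<alpha> \<Longrightarrow> 0 \<le> \<beta> \<Longrightarrow> 0 \<le> \<epsilon> \<Longrightarrow> 0 \<le> penalty \<alpha> \<beta> \<epsilon> x y"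
  by (simp add: penalty_def sum_nonneg)

text \<open>
  Up to the contribution of \<open>\<epsilon>\<close>, the gradients in the first and second argument are opposite to
  each other. This is why both viscosity inequalities see the same momentum.
\<close>

lemma penalty_first:
  fixes x y :: "'n::finite point"
  shows "cont_derivs k (\<lambda>x. penalty \<alpha> \<beta> \<epsilon> x y)"
    and "GDERIV (\<lambda>x. penalty \<alpha> \<beta> \<epsilon> x y) x :>
      (\<chi> a. - (\<alpha> * flat' (fst y $ a - fst x $ a)), \<chi> e. \<beta> * (snd x $ e - snd y $ e) + \<epsilon> * snd x $ e)"
proof -
  define A where "A = (\<lambda>a r. \<alpha> * flat (fst y $ a - r))"
  define B where "B = (\<lambda>e r. \<beta> / 2 * (r - snd y $ e)\<^sup>2 + \<epsilon> / 2 * (r\<^sup>2 + (snd y $ e)\<^sup>2))"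
  have eq: "(\<lambda>x. penalty \<alpha> \<beta> \<epsilon> x y) =
      (\<lambda>x. (\<Sum>a\<in>UNIV. A a (fst x $ a)) + (\<Sum>e\<in>UNIV. B e (snd x $ e)))"
    by (simp add: penalty_def A_def B_def norm_square_vec sum_distrib_left sum.distrib distrib_left add.assoc)
  show "cont_derivs k (\<lambda>x. penalty \<alpha> \<beta> \<epsilon> x y)"
    unfolding eq
  proof (rule cont_derivs_coordinate_sums)
    show "cont_derivs k (A a)" for a
      unfolding A_def
      by (intro cont_derivs_mult cont_derivs_const cont_derivs_compose_real[OF cont_derivs_flat]
          cont_derivs_diff cont_derivs_ident)
    show "cont_derivs k (B e)" for e
      unfolding B_def
      by (intro cont_derivs_add cont_derivs_mult cont_derivs_const cont_derivs_square
          cont_derivs_diff cont_derivs_ident)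
  qed
  have A: "DERIV (A a) r :> - (\<alpha> * flat' (fst y $ a - r))" for a r
    unfolding A_def by (auto intro!: derivative_eq_intros DERIV_chain2[OF DERIV_flat])
  have B: "DERIV (B e) r :> \<beta> * (r - snd y $ e) + \<epsilon> * r" for e r
    unfolding B_def by (auto intro!: derivative_eq_intros)
  show "GDERIV (\<lambda>x. penalty \<alpha> \<beta> \<epsilon> x y) x :>
      (\<chi> a. - (\<alpha> * flat' (fst y $ a - fst x $ a)), \<chi> e. \<beta> * (snd x $ e - snd y $ e) + \<epsilon> * snd x $ e)"
    unfolding eq by (rule GDERIV_coordinate_sums[OF A B])
qed

lemma penalty_second:
  fixes x y :: "'n::finite point"
  shows "cont_derivs k (\<lambda>y. penalty \<alpha> \<beta> \<epsilon> x y)"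
    and "GDERIV (\<lambda>y. penalty \<alpha> \<beta> \<epsilon> x y) y :>
      (\<chi> a. \<alpha> * flat' (fst y $ a - fst x $ a), \<chi> e. - (\<beta> * (snd x $ e - snd y $ e)) + \<epsilon> * snd y $ e)"
proof -
  define A where "A = (\<lambda>a r. \<alpha> * flat (r - fst x $ a))"
  define B where "B = (\<lambda>e r. \<beta> / 2 * (snd x $ e - r)\<^sup>2 + \<epsilon> / 2 * ((snd x $ e)\<^sup>2 + r\<^sup>2))"
  have eq: "(\<lambda>y. penalty \<alpha> \<beta> \<epsilon> x y) =
      (\<lambda>y. (\<Sum>a\<in>UNIV. A a (fst y $ a)) + (\<Sum>e\<in>UNIV. B e (snd y $ e)))"
    by (simp add: penalty_def A_def B_def norm_square_vec sum_distrib_left sum.distrib distrib_left add.assoc)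
  show "cont_derivs k (\<lambda>y. penalty \<alpha> \<beta> \<epsilon> x y)"
    unfolding eq
  proof (rule cont_derivs_coordinate_sums)
    show "cont_derivs k (A a)" for a
      unfolding A_def
      by (intro cont_derivs_mult cont_derivs_const cont_derivs_compose_real[OF cont_derivs_flat]
          cont_derivs_diff cont_derivs_ident)
    show "cont_derivs k (B e)" for e
      unfolding B_def
      by (intro cont_derivs_add cont_derivs_mult cont_derivs_const cont_derivs_square
          cont_derivs_diff cont_derivs_ident)
  qed
  have A: "DERIV (A a) r :> \<alpha> * flat' (r - fst x $ a)" for a r
    unfolding A_def by (auto intro!: derivative_eq_intros DERIV_chain2[OF DERIV_flat])
  have B: "DERIV (B e) r :> - (\<beta> * (snd x $ e - r)) + \<epsilon> * r" for e r
    unfolding B_def by (auto intro!: derivative_eq_intros simp: field_simps)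
  show "GDERIV (\<lambda>y. penalty \<alpha> \<beta> \<epsilon> x y) y :>
      (\<chi> a. \<alpha> * flat' (fst y $ a - fst x $ a), \<chi> e. - (\<beta> * (snd x $ e - snd y $ e)) + \<epsilon> * snd y $ e)"
    unfolding eq by (rule GDERIV_coordinate_sums[OF A B])
qed


section \<open>The simplex and proper kernels\<close>

lemma prob_simplex_le_1: "\<mu> \<in> prob_simplex \<Longrightarrow> \<mu> $ a \<le> 1"
  unfolding prob_simplex_def using member_le_sum[of a UNIV "\<lambda>a. \<mu> $ a"] by auto

lemma compact_prob_simplex: "compact (prob_simplex :: 'n::finite weights set)"
proof (rule compact_eq_bounded_closed[THEN iffD2], intro conjI)
  show "bounded (prob_simplex :: 'n weights set)"
    unfolding bounded_iff
  proof (intro exI ballI)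
    fix \<mu> :: "'n weights" assume \<mu>: "\<mu> \<in> prob_simplex"
    have "norm \<mu> \<le> (\<Sum>a\<in>UNIV. \<bar>\<mu> $ a\<bar>)"
      by (rule norm_le_l1_cart)
    also have "\<dots> = 1"
      using \<mu> by (simp add: prob_simplex_def)
    finally show "norm \<mu> \<le> 1" .
  qed
  have "closed {\<mu> :: 'n weights. 0 \<le> \<mu> $ a}" for a
    by (intro closed_Collect_le continuous_intros)
  moreover have "closed {\<mu> :: 'n weights. (\<Sum>a\<in>UNIV. \<mu> $ a) = 1}"
    by (intro closed_Collect_eq continuous_intros)
  ultimately show "closed (prob_simplex :: 'n weights set)"
    unfolding prob_simplex_def by (intro closed_Collect_conj closed_Collect_all)
qed

lemma compact_truncated_state_space:
  "compact {x \<in> state_space :: 'n::finite point set. norm (snd x) \<le> r}"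
proof -
  have "closed {w :: (real, 'n edge) vec. \<forall>e. 0 \<le> w $ e}"
    by (intro closed_Collect_all closed_Collect_le continuous_intros)
  then have "compact ({w :: (real, 'n edge) vec. \<forall>e. 0 \<le> w $ e} \<inter> cball 0 r)"
    by (intro closed_Int_compact compact_cball)
  then have "compact ((prob_simplex :: 'n weights set) \<times> ({w :: (real, 'n edge) vec. \<forall>e. 0 \<le> w $ e} \<inter> cball 0 r))"
    by (intro compact_Times compact_prob_simplex)
  moreover have "{x \<in> state_space :: 'n point set. norm (snd x) \<le> r} =
      prob_simplex \<times> ({w. \<forall>e. 0 \<le> w $ e} \<inter> cball 0 r)"
    by (auto simp: state_space_def)
  ultimately show ?thesis
    by simp
qed

text \<open>
  The hypothesis bounds \<open>\<nu> $ a - \<mu> $ a\<close> from above only. The other direction follows because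
  the two measures have the same mass: an excess of \<open>\<mu>\<close> at \<open>b\<close> is compensated by its deficits
  elsewhere.
\<close>

lemma dist_less_if_flat_small:
  assumes "\<delta> > 0"
  obtains \<kappa> where "\<kappa> > 0"
    "\<And>\<mu> \<nu> :: 'n::finite weights. \<mu> \<in> prob_simplex \<Longrightarrow> \<nu> \<in> prob_simplex \<Longrightarrow>
      (\<And>a. flat (\<nu> $ a - \<mu> $ a) < \<kappa>) \<Longrightarrow> dist \<mu> \<nu> < \<delta>"
proof
  define N where "N = real (CARD('n option))"
  define d where "d = \<delta> / (2 * N * N)"
  have N: "N \<ge> 1"
    unfolding N_def by (simp add: Suc_leI)
  then have d: "d > 0"
    using assms by (simp add: d_def)
  then show "flat d > 0"
    by (rule flat_pos)
  fix \<mu> \<nu> :: "'n weights"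
  assume simp: "\<mu> \<in> prob_simplex" "\<nu> \<in> prob_simplex" and small: "\<And>a. flat (\<nu> $ a - \<mu> $ a) < flat d"
  have up: "\<nu> $ a - \<mu> $ a < d" for a
    using small[of a] flat_mono[of d "\<nu> $ a - \<mu> $ a"] by linarith
  have "\<bar>(\<mu> - \<nu>) $ b\<bar> \<le> N * d" for b
  proof -
    have "(\<Sum>a\<in>UNIV. \<nu> $ a - \<mu> $ a) = 0"
      using simp by (simp add: prob_simplex_def sum_subtractf)
    then have "\<mu> $ b - \<nu> $ b = (\<Sum>a\<in>UNIV - {b}. \<nu> $ a - \<mu> $ a)"
      by (simp add: sum.remove[of UNIV b])
    also have "\<dots> \<le> real (card (UNIV - {b})) * d"
      using up by (intro sum_bounded_above) (simp add: less_imp_le)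
    also have "\<dots> \<le> N * d"
      using d by (intro mult_right_mono) (auto simp: N_def card_mono)
    finally have "\<mu> $ b - \<nu> $ b \<le> N * d" .
    moreover have "d \<le> N * d"
      using d N by simp
    ultimately show ?thesis
      using up[of b] by (simp add: abs_if)
  qed
  then have "(\<Sum>b\<in>UNIV. \<bar>(\<mu> - \<nu>) $ b\<bar>) \<le> N * (N * d)"
    unfolding N_def by (intro sum_bounded_above[where A = UNIV, simplified]) 
  then have "norm (\<mu> - \<nu>) \<le> N * (N * d)"
    using norm_le_l1_cart[of "\<mu> - \<nu>"] by linarith
  also have "\<dots> = \<delta> / 2"
    using N by (simp add: d_def)
  finally show "dist \<mu> \<nu> < \<delta>"
    using assms by (simp add: dist_norm)
qed

lemma proper_kernel_bounded:
  assumes "proper_kernel v"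
  obtains V where "0 \<le> V" "\<And>e \<mu>. \<mu> \<in> prob_simplex \<Longrightarrow> v e \<mu> \<le> V"
proof -
  have "\<exists>b. \<forall>\<mu>\<in>prob_simplex. v e \<mu> \<le> b" for e
  proof -
    have "bounded (v e ` prob_simplex)"
      using assms compact_prob_simplex unfolding proper_kernel_def
      by (intro compact_imp_bounded compact_continuous_image) auto
    then show ?thesis
      unfolding bounded_iff by (metis abs_le_D1 image_eqI real_norm_def)
  qed
  then obtain b where b: "\<And>e \<mu>. \<mu> \<in> prob_simplex \<Longrightarrow> v e \<mu> \<le> b e"
    by metis
  show thesis
  proof
    show "0 \<le> (\<Sum>e\<in>UNIV. \<bar>b e\<bar>)"
      by (simp add: sum_nonneg)
    show "v e \<mu> \<le> (\<Sum>e\<in>UNIV. \<bar>b e\<bar>)" if "\<mu> \<in> prob_simplex" for e \<mu>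
    proof -
      have "\<bar>b e\<bar> \<le> (\<Sum>e\<in>UNIV. \<bar>b e\<bar>)"
        by (rule member_le_sum) auto
      then show ?thesis
        using b[OF that, of e] by linarith
    qed
  qed
qed

text \<open>
  Where \<open>\<nu>\<close> has more mass at the source, the bound is multiplicative: the increasing factor can
  only be smaller at \<open>\<mu>\<close>, and the continuous factor varies by at most the fraction \<open>\<eta>\<close> of its
  positive infimum. An additive bound would be useless there, since it is going to be
  multiplied by unbounded exponentials.
\<close>

lemma proper_kernel_modulus:
  fixes v :: "'n::finite edge \<Rightarrow> 'n weights \<Rightarrow> real"
  assumes v: "proper_kernel v" and \<eta>: "\<eta> > 0"
  obtains \<delta> where "\<delta> > 0"
    "\<And>e \<mu> \<nu>. \<mu> \<in> prob_simplex \<Longrightarrow> \<nu> \<in> prob_simplex \<Longrightarrow> dist \<mu> \<nu> < \<delta> \<Longrightarrow> \<bar>v e \<mu> - v e \<nu>\<bar> \<le> \<eta>"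
    "\<And>e \<mu> \<nu>. \<mu> \<in> prob_simplex \<Longrightarrow> \<nu> \<in> prob_simplex \<Longrightarrow> dist \<mu> \<nu> < \<delta> \<Longrightarrow>
      \<mu> $ source e < \<nu> $ source e \<Longrightarrow> v e \<mu> \<le> (1 + \<eta>) * v e \<nu>"
proof -
  have unif: "\<exists>\<delta>>0. \<forall>\<mu>\<in>prob_simplex. \<forall>\<nu>\<in>prob_simplex. dist \<mu> \<nu> < \<delta> \<longrightarrow> \<bar>g \<mu> - g \<nu>\<bar> \<le> c"
    if "continuous_on prob_simplex g" "c > 0" for g :: "'n weights \<Rightarrow> real" and c
  proof -
    have "uniformly_continuous_on prob_simplex g"
      using that(1) compact_prob_simplex by (rule compact_uniformly_continuous)
    then show ?thesis
      using that(2) unfolding uniformly_continuous_on_def dist_real_def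
      by (metis dist_commute less_imp_le)
  qed
  have "\<exists>\<delta>>0. \<forall>\<mu>\<in>prob_simplex. \<forall>\<nu>\<in>prob_simplex. dist \<mu> \<nu> < \<delta> \<longrightarrow>
      \<bar>v e \<mu> - v e \<nu>\<bar> \<le> \<eta> \<and> (\<mu> $ source e < \<nu> $ source e \<longrightarrow> v e \<mu> \<le> (1 + \<eta>) * v e \<nu>)" for e
  proof (cases "\<forall>\<mu>\<in>prob_simplex. v e \<mu> = 0")
    case True
    then show ?thesis
      using \<eta> by (intro exI[of _ 1]) auto
  next
    case False
    obtain \<delta>1 where \<delta>1: "\<delta>1 > 0"
      "\<And>\<mu> \<nu>. \<mu> \<in> prob_simplex \<Longrightarrow> \<nu> \<in> prob_simplex \<Longrightarrow> dist \<mu> \<nu> < \<delta>1 \<Longrightarrow> \<bar>v e \<mu> - v e \<nu>\<bar> \<le> \<eta>"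
    proof -
      have "continuous_on prob_simplex (v e)"
        using v unfolding proper_kernel_def by blast
      from unif[OF this \<eta>] show thesis
        using that by blast
    qed
    obtain v1 v2 where eq: "\<And>\<mu>. \<mu> \<in> prob_simplex \<Longrightarrow> v e \<mu> = v1 (\<mu> $ source e) * v2 \<mu>"
      and v1: "\<And>r. r \<in> {0..1} \<Longrightarrow> 0 \<le> v1 r" "mono_on {0..1} v1"
      and v2: "\<And>\<mu>. \<mu> \<in> prob_simplex \<Longrightarrow> 0 \<le> v2 \<mu>" "continuous_on prob_simplex v2"
        "0 < (INF \<mu>\<in>prob_simplex. v2 \<mu>)"
    proof -
      have "\<exists>v1 v2. (\<forall>\<mu>\<in>prob_simplex. v e \<mu> = v1 (\<mu> $ source e) * v2 \<mu>) \<and>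
          (\<forall>r\<in>{0..1}. 0 \<le> v1 r) \<and> mono_on {0..1} v1 \<and> (\<forall>\<mu>\<in>prob_simplex. 0 \<le> v2 \<mu>) \<and>
          continuous_on prob_simplex v2 \<and> 0 < (INF \<mu>\<in>prob_simplex. v2 \<mu>)"
        using v False unfolding proper_kernel_def by blast
      then show thesis
        using that by blast
    qed
    define m where "m = (INF \<mu>\<in>prob_simplex. v2 \<mu>)"
    have m: "m > 0" "\<And>\<mu>. \<mu> \<in> prob_simplex \<Longrightarrow> m \<le> v2 \<mu>"
      using v2 unfolding m_def by (auto intro!: cINF_lower bdd_belowI2[of _ 0])
    obtain \<delta>2 where \<delta>2: "\<delta>2 > 0"
      "\<And>\<mu> \<nu>. \<mu> \<in> prob_simplex \<Longrightarrow> \<nu> \<in> prob_simplex \<Longrightarrow> dist \<mu> \<nu> < \<delta>2 \<Longrightarrow> \<bar>v2 \<mu> - v2 \<nu>\<bar> \<le> \<eta> * m"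
      using unif[of v2 "\<eta> * m"] v2(2) \<eta> m(1) by auto
    have "v e \<mu> \<le> (1 + \<eta>) * v e \<nu>"
      if *: "\<mu> \<in> prob_simplex" "\<nu> \<in> prob_simplex" "dist \<mu> \<nu> < \<delta>2" "\<mu> $ source e < \<nu> $ source e" for \<mu> \<nu>
    proof -
      have r: "\<mu> $ source e \<in> {0..1}" "\<nu> $ source e \<in> {0..1}"
        using *(1,2) prob_simplex_le_1 by (auto simp: prob_simplex_def)
      have "v2 \<mu> \<le> v2 \<nu> + \<eta> * m"
        using \<delta>2(2)[OF *(1-3)] by linarith
      also have "\<dots> \<le> v2 \<nu> + \<eta> * v2 \<nu>"
        using m(2)[OF *(2)] \<eta> by simp
      finally have "v2 \<mu> \<le> (1 + \<eta>) * v2 \<nu>"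
        by (simp add: algebra_simps)
      moreover have "v1 (\<mu> $ source e) \<le> v1 (\<nu> $ source e)"
        using mono_onD[OF v1(2) r] *(4) by simp
      ultimately have "v1 (\<mu> $ source e) * v2 \<mu> \<le> v1 (\<nu> $ source e) * ((1 + \<eta>) * v2 \<nu>)"
        using v1(1)[OF r(2)] v2(1)[OF *(1)] by (intro mult_mono)
      then show ?thesis
        using eq[OF *(1)] eq[OF *(2)] by (simp add: mult.left_commute)
    qed
    with \<delta>1 \<delta>2(1) show ?thesis
      by (intro exI[of _ "min \<delta>1 \<delta>2"]) auto
  qed
  then obtain d where d: "\<And>e. d e > 0"
    "\<And>e \<mu> \<nu>. \<mu> \<in> prob_simplex \<Longrightarrow> \<nu> \<in> prob_simplex \<Longrightarrow> dist \<mu> \<nu> < d e \<Longrightarrow> \<bar>v e \<mu> - v e \<nu>\<bar> \<le> \<eta>"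
    "\<And>e \<mu> \<nu>. \<mu> \<in> prob_simplex \<Longrightarrow> \<nu> \<in> prob_simplex \<Longrightarrow> dist \<mu> \<nu> < d e \<Longrightarrow>
      \<mu> $ source e < \<nu> $ source e \<Longrightarrow> v e \<mu> \<le> (1 + \<eta>) * v e \<nu>"
    by metis
  have "Min (range d) > 0"
    using d(1) by simp
  moreover have "Min (range d) \<le> d e" for e
    by simp
  ultimately show thesis
    using that[of "Min (range d)"] d(2,3) by (meson order_less_le_trans)
qed

text \<open>
  The difference of the two Hamiltonians on one edge, with \<open>x\<close> and \<open>y\<close> the rates at \<open>\<mu>\<close> and
  \<open>\<nu>\<close>, \<open>q\<close> the common exponent and \<open>s\<close>, \<open>t\<close> the perturbations due to the containment term. The
  bound does not involve \<open>q\<close>: either \<open>q\<close> is bounded and \<open>x \<le> y + \<eta>\<close> is enough, or \<open>x\<close> is at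
  most a multiple of \<open>y\<close> and the bound \<open>C\<close> on the term at \<open>\<nu>\<close> takes over.
\<close>

lemma exp_flux_difference_le:
  fixes x y :: real
  assumes C: "y * exp (q - t) \<le> C" and y: "0 \<le> y" and \<eta>: "0 \<le> \<eta>"
    and st: "\<bar>s\<bar> \<le> \<sigma>" "\<bar>t\<bar> \<le> \<sigma>"
    and close: "\<bar>x - y\<bar> \<le> \<eta>"
    and cases: "q \<le> B \<or> x \<le> (1 + \<eta>) * y"
  shows "x * (exp (q + s) - 1) - y * (exp (q - t) - 1) \<le>
    C * (exp (2 * \<sigma>) - 1) + \<eta> * (C * exp (2 * \<sigma>) + exp (B + \<sigma>) + 1)"
proof -
  have C0: "0 \<le> C"
    using C y by (meson exp_ge_zero mult_nonneg_nonneg order_trans)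
  have "y * exp (q + s) = y * exp (q - t) * exp (s + t)"
    by (simp add: mult.assoc flip: exp_add)
  also have "\<dots> \<le> y * exp (q - t) * exp (2 * \<sigma>)"
    using st y by (intro mult_left_mono) auto
  finally have 1: "y * exp (q + s) \<le> y * exp (q - t) * exp (2 * \<sigma>)" .
  have \<sigma>: "1 \<le> exp (2 * \<sigma>)"
    using st by simp
  have "x * exp (q + s) - y * exp (q - t) \<le>
    C * (exp (2 * \<sigma>) - 1) + \<eta> * (C * exp (2 * \<sigma>) + exp (B + \<sigma>))"
    using cases
  proof
    assume q: "q \<le> B"
    have "x * exp (q + s) \<le> (y + \<eta>) * exp (q + s)"
      using close by (intro mult_right_mono) auto
    also have "\<dots> = y * exp (q + s) + \<eta> * exp (q + s)"
      by (simp add: distrib_right)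
    also have "\<dots> \<le> y * exp (q - t) * exp (2 * \<sigma>) + \<eta> * exp (B + \<sigma>)"
      using q st \<eta> by (intro add_mono 1 mult_left_mono) auto
    finally have "x * exp (q + s) - y * exp (q - t) \<le> y * exp (q - t) * (exp (2 * \<sigma>) - 1) + \<eta> * exp (B + \<sigma>)"
      by (simp add: algebra_simps)
    also have "\<dots> \<le> C * (exp (2 * \<sigma>) - 1) + \<eta> * (C * exp (2 * \<sigma>) + exp (B + \<sigma>))"
      using C C0 \<sigma> \<eta> by (intro add_mono mult_right_mono mult_left_mono) auto
    finally show ?thesis .
  next
    assume x: "x \<le> (1 + \<eta>) * y"
    have "x * exp (q + s) \<le> (1 + \<eta>) * y * exp (q + s)"
      using x by (intro mult_right_mono) auto
    also have "\<dots> = (1 + \<eta>) * (y * exp (q + s))"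
      by simp
    also have "\<dots> \<le> (1 + \<eta>) * (y * exp (q - t) * exp (2 * \<sigma>))"
      using 1 \<eta> by (intro mult_left_mono) auto
    finally have "x * exp (q + s) - y * exp (q - t) \<le>
        y * exp (q - t) * (exp (2 * \<sigma>) - 1) + \<eta> * (y * exp (q - t) * exp (2 * \<sigma>))"
      by (simp add: algebra_simps)
    also have "\<dots> \<le> C * (exp (2 * \<sigma>) - 1) + \<eta> * (C * exp (2 * \<sigma>) + exp (B + \<sigma>))"
      using C C0 \<sigma> \<eta> by (intro add_mono mult_right_mono mult_left_mono add_increasing2) auto
    finally show ?thesis .
  qed
  then show ?thesis
    using close by (simp add: algebra_simps)
qed


section \<open>Doubling of variables\<close>

text \<open>
  Outside the truncation at radius \<open>r\<close> the containment term alone is at least \<open>4 * M\<close>, which is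
  the most by which values of \<open>u x - u' y\<close> can differ.
\<close>

lemma penalized_difference_attains_max:
  fixes u u' :: "'n::finite point \<Rightarrow> real"
  assumes u: "upper_semicontinuous_on state_space u" and u': "lower_semicontinuous_on state_space u'"
    and M: "\<And>x. x \<in> state_space \<Longrightarrow> \<bar>u x\<bar> \<le> M" "\<And>x. x \<in> state_space \<Longrightarrow> \<bar>u' x\<bar> \<le> M"
    and pos: "0 \<le> \<alpha>" "0 \<le> \<beta>" "0 < \<epsilon>"
  obtains x y where "x \<in> state_space" "y \<in> state_space"
    "\<And>x' y'. x' \<in> state_space \<Longrightarrow> y' \<in> state_space \<Longrightarrow>
       u x' - u' y' - penalty \<alpha> \<beta> \<epsilon> x' y' \<le> u x - u' y - penalty \<alpha> \<beta> \<epsilon> x y"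
proof -
  define o0 :: "'n point" where "o0 = (axis None 1, 0)"
  have o0: "o0 \<in> state_space"
    by (auto simp: o0_def state_space_def prob_simplex_def axis_def)
  have M0: "M \<ge> 0"
    using M(1)[OF o0] by linarith
  define r where "r = sqrt (8 * M / \<epsilon>)"
  define K where "K = {x \<in> state_space :: 'n point set. norm (snd x) \<le> r}"
  define W where "W = (\<lambda>z. u (fst z) - u' (snd z) - penalty \<alpha> \<beta> \<epsilon> (fst z) (snd z))"
  have r: "r \<ge> 0" "r\<^sup>2 = 8 * M / \<epsilon>"
    using M0 pos by (simp_all add: r_def)
  have o0K: "o0 \<in> K"
    using o0 r by (simp add: K_def) (simp add: o0_def)
  have K: "compact (K \<times> K)" "K \<times> K \<noteq> {}" "K \<subseteq> state_space"
  proof -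
    show "compact (K \<times> K)"
      unfolding K_def by (intro compact_Times compact_truncated_state_space)
    show "K \<times> K \<noteq> {}"
      using o0K by auto
  qed (auto simp: K_def)
  have "upper_semicontinuous_on (K \<times> K) W"
  proof -
    have "upper_semicontinuous_on (K \<times> K) (\<lambda>z. u (fst z))"
      using K(3) by (intro upper_semicontinuous_on_compose[OF u] continuous_intros) auto
    moreover have "upper_semicontinuous_on state_space (\<lambda>x. - u' x)"
      unfolding upper_semicontinuous_on_def
    proof (intro ballI allI impI)
      fix x c assume "x \<in> state_space" "- u' x < c"
      then have "eventually (\<lambda>y. - c < u' y) (at x within state_space)"
        using u' unfolding lower_semicontinuous_on_def by simp
      then show "eventually (\<lambda>y. - u' y < c) (at x within state_space)"
        by eventually_elim simp
    qed
    then have "upper_semicontinuous_on (K \<times> K) (\<lambda>z. - u' (snd z))"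
      by (rule upper_semicontinuous_on_compose[of state_space "\<lambda>x. - u' x" _ snd])
        (use K(3) in \<open>auto intro!: continuous_intros\<close>)
    moreover have flat: "continuous_on (K \<times> K) (\<lambda>z. flat (g z))" if "continuous_on (K \<times> K) g" for g
      using cont_derivs_flat[of 0] that by (auto intro: continuous_on_compose2[of UNIV flat])
    then have "continuous_on (K \<times> K) (\<lambda>z. - penalty \<alpha> \<beta> \<epsilon> (fst z) (snd z))"
      unfolding penalty_def
      by (intro continuous_intros flat)
    ultimately have "upper_semicontinuous_on (K \<times> K)
        (\<lambda>z. (u (fst z) + - u' (snd z)) + - penalty \<alpha> \<beta> \<epsilon> (fst z) (snd z))"
      by (simp only: upper_semicontinuous_on_add continuous_on_imp_upper_semicontinuous_on)
    then show ?thesis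
      by (simp add: W_def)
  qed
  then obtain z where z: "z \<in> K \<times> K" "\<And>z'. z' \<in> K \<times> K \<Longrightarrow> W z' \<le> W z"
    using upper_semicontinuous_on_compact_attains_max[OF _ K(1,2)] by blast
  have "W (o0, o0) \<le> W z"
    using z(2) o0K by simp
  moreover have "W (o0, o0) \<ge> - 2 * M"
    using M(1)[OF o0] M(2)[OF o0] by (simp add: W_def penalty_def o0_def flat_eq)
  ultimately have low: "- 2 * M \<le> W z"
    by linarith
  have "W (x', y') \<le> W z" if xy: "x' \<in> state_space" "y' \<in> state_space" for x' y'
  proof (cases "x' \<in> K \<and> y' \<in> K")
    case True
    then show ?thesis
      using z(2) by simp
  next
    case False
    then have "r < norm (snd x') \<or> r < norm (snd y')"
      using xy by (auto simp: K_def)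
    then have "r\<^sup>2 \<le> (norm (snd x'))\<^sup>2 \<or> r\<^sup>2 \<le> (norm (snd y'))\<^sup>2"
      using r(1) by (meson less_imp_le power_mono)
    then have "r\<^sup>2 \<le> (norm (snd x'))\<^sup>2 + (norm (snd y'))\<^sup>2"
      by (smt (verit) zero_le_power2)
    then have "\<epsilon> / 2 * r\<^sup>2 \<le> \<epsilon> / 2 * ((norm (snd x'))\<^sup>2 + (norm (snd y'))\<^sup>2)"
      using pos(3) by (intro mult_left_mono) auto
    also have "\<dots> \<le> penalty \<alpha> \<beta> \<epsilon> x' y'"
      using pos by (simp add: penalty_def sum_nonneg)
    finally have "4 * M \<le> penalty \<alpha> \<beta> \<epsilon> x' y'"
      using pos(3) by (simp add: r(2))
    then show ?thesis
      using M(1)[OF xy(1)] M(2)[OF xy(2)] low by (simp add: W_def)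
  qed
  then show thesis
    using z(1) K(3) by (intro that[of "fst z" "snd z"]) (auto simp: W_def)
qed

context flux_operator
begin

lemma doubling_inequalities:
  assumes sub: "viscosity_subsolution state_space D H lam h u"
    and super: "viscosity_supersolution state_space D H lam h u'"
    and pos: "0 \<le> \<alpha>" "0 \<le> \<beta>" "0 \<le> \<epsilon>"
    and xy: "x \<in> state_space" "y \<in> state_space"
    and max: "\<And>x' y'. x' \<in> state_space \<Longrightarrow> y' \<in> state_space \<Longrightarrow>
       u x' - u' y' - penalty \<alpha> \<beta> \<epsilon> x' y' \<le> u x - u' y - penalty \<alpha> \<beta> \<epsilon> x y"
  defines "q \<equiv> \<lambda>e. \<alpha> * flat' (fst y $ source e - fst x $ source e)
      - \<alpha> * flat' (fst y $ target e - fst x $ target e) + \<beta> * (snd x $ e - snd y $ e)"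
  shows "u x - h x \<le> lam * (\<Sum>e\<in>UNIV. v e (fst x) * (exp (q e + \<epsilon> * snd x $ e) - 1))"
    and "lam * (\<Sum>e\<in>UNIV. v e (fst y) * (exp (q e - \<epsilon> * snd y $ e) - 1)) \<le> u' y - h y"
proof -
  have "u x - lam * hamiltonian v x
      (\<chi> a. - (\<alpha> * flat' (fst y $ a - fst x $ a)), \<chi> e. \<beta> * (snd x $ e - snd y $ e) + \<epsilon> * snd x $ e)
      - h x \<le> 0"
  proof (rule subsolution_at_maximum[OF sub penalty_first(1) _ penalty_first(2) xy(1)])
    show "u z - penalty \<alpha> \<beta> \<epsilon> z y \<le> u x - penalty \<alpha> \<beta> \<epsilon> x y" if "z \<in> state_space" for z
      using max[OF that xy(2)] by simp
    show "0 \<le> penalty \<alpha> \<beta> \<epsilon> z y" for z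
      using pos by (rule penalty_nonneg)
  qed
  then show "u x - h x \<le> lam * (\<Sum>e\<in>UNIV. v e (fst x) * (exp (q e + \<epsilon> * snd x $ e) - 1))"
    by (simp add: hamiltonian_def q_def algebra_simps)
  have "u' y - lam * hamiltonian v y
      (- (\<chi> a. \<alpha> * flat' (fst y $ a - fst x $ a), \<chi> e. - (\<beta> * (snd x $ e - snd y $ e)) + \<epsilon> * snd y $ e))
      - h y \<ge> 0"
  proof (rule supersolution_at_minimum[OF super penalty_second(1) _ penalty_second(2) xy(2)])
    show "u' y + penalty \<alpha> \<beta> \<epsilon> x y \<le> u' z + penalty \<alpha> \<beta> \<epsilon> x z" if "z \<in> state_space" for z
      using max[OF xy(1) that] by simp
    show "0 \<le> penalty \<alpha> \<beta> \<epsilon> x z" for z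
      using pos by (rule penalty_nonneg)
  qed
  then show "lam * (\<Sum>e\<in>UNIV. v e (fst y) * (exp (q e - \<epsilon> * snd y $ e) - 1)) \<le> u' y - h y"
    by (simp add: hamiltonian_def q_def algebra_simps)
qed

text \<open>
  Every summand is at least \<open>- V\<close>, so an upper bound on the Hamiltonian bounds each of its
  exponential terms.
\<close>

lemma hamiltonian_term_bounded:
  fixes q :: "'n edge \<Rightarrow> real"
  assumes y: "\<nu> \<in> prob_simplex" and V: "\<And>e. v e \<nu> \<le> V"
    and R: "(\<Sum>e\<in>UNIV. v e \<nu> * (exp (q e) - 1)) \<le> R"
  shows "v e \<nu> * exp (q e) \<le> R + real (CARD('n edge)) * V"
proof -
  have nonneg: "0 \<le> v e \<nu>" for e
    using kernel y unfolding proper_kernel_def by blast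
  have "v e \<nu> * exp (q e) \<le> (\<Sum>e\<in>UNIV. v e \<nu> * exp (q e))"
    using nonneg by (intro member_le_sum) auto
  also have "\<dots> = (\<Sum>e\<in>UNIV. v e \<nu> * (exp (q e) - 1)) + (\<Sum>e\<in>UNIV. v e \<nu>)"
    by (simp add: right_diff_distrib sum_subtractf)
  also have "(\<Sum>e\<in>UNIV. v e \<nu>) \<le> real (CARD('n edge)) * V"
    by (rule sum_bounded_above) (rule V)
  finally show ?thesis
    using R by simp
qed

lemma subsolution_le_supersolution:
  assumes sub: "viscosity_subsolution state_space D H lam h u"
    and super: "viscosity_supersolution state_space D H lam h u'"
    and x0: "x0 \<in> state_space"
  shows "u x0 \<le> u' x0"
proof (rule ccontr)
  define \<theta> where "\<theta> = u x0 - u' x0"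
  assume "\<not> u x0 \<le> u' x0"
  then have \<theta>: "\<theta> > 0"
    by (simp add: \<theta>_def)
  obtain M where M: "M \<ge> 1" "\<And>x. x \<in> state_space \<Longrightarrow> \<bar>u x\<bar> \<le> M"
    "\<And>x. x \<in> state_space \<Longrightarrow> \<bar>u' x\<bar> \<le> M" "\<And>x. x \<in> state_space \<Longrightarrow> \<bar>h x\<bar> \<le> M"
  proof -
    have "bounded (u ` state_space)" "bounded (u' ` state_space)" "bounded (h ` state_space)"
      using sub super h unfolding viscosity_subsolution_def viscosity_supersolution_def C_b_def by auto
    then obtain a b c where "\<forall>x\<in>state_space. \<bar>u x\<bar> \<le> a"
      "\<forall>x\<in>state_space. \<bar>u' x\<bar> \<le> b" "\<forall>x\<in>state_space. \<bar>h x\<bar> \<le> c"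
      unfolding bounded_iff by (metis image_eqI real_norm_def)
    then show thesis
      by (intro that[of "max 1 (max a (max b c))"]) (metis max.cobounded1 max.coboundedI2 max.coboundedI1)+
  qed
  obtain V where V: "0 \<le> V" "\<And>e \<mu>. \<mu> \<in> prob_simplex \<Longrightarrow> v e \<mu> \<le> V"
    using proper_kernel_bounded[OF kernel] by blast
  define N where "N = real (CARD('n edge))"
  define C where "C = 2 * M / lam + N * V"
  have N: "N \<ge> 0"
    by (simp add: N_def)
  have C: "C \<ge> 0"
    using M(1) V(1) N lam by (simp add: C_def)

  \<comment> \<open>The constant \<open>C\<close> will bound the exponential terms at \<open>y\<close>; it is independent of \<open>\<epsilon>\<close>, so the
      error factor \<open>exp (2 * \<sigma>) - 1\<close> below can be made small against it.\<close>
  obtain \<epsilon> where \<epsilon>: "\<epsilon> > 0" "\<epsilon> * (norm (snd x0))\<^sup>2 < \<theta> / 2"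
    "lam * N * C * (exp (2 * (2 * sqrt (M * \<epsilon>))) - 1) < \<theta> / 16"
  proof -
    have "((\<lambda>\<epsilon>. \<epsilon> * (norm (snd x0))\<^sup>2) \<longlongrightarrow> 0 * (norm (snd x0))\<^sup>2) (at_right 0)"
      by (intro tendsto_intros)
    then have "eventually (\<lambda>\<epsilon>. \<epsilon> * (norm (snd x0))\<^sup>2 < \<theta> / 2) (at_right 0)"
      using \<theta> by (intro order_tendstoD(2)) auto
    moreover have "((\<lambda>\<epsilon>. lam * N * C * (exp (2 * (2 * sqrt (M * \<epsilon>))) - 1)) \<longlongrightarrow>
        lam * N * C * (exp (2 * (2 * sqrt (M * 0))) - 1)) (at_right 0)"
      by (intro tendsto_intros)
    then have "eventually (\<lambda>\<epsilon>. lam * N * C * (exp (2 * (2 * sqrt (M * \<epsilon>))) - 1) < \<theta> / 16) (at_right 0)"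
      using \<theta> by (intro order_tendstoD(2)) auto
    moreover have "eventually (\<lambda>\<epsilon>::real. \<epsilon> > 0) (at_right 0)"
      by (rule eventually_at_right_less)
    ultimately have "eventually (\<lambda>\<epsilon>. \<epsilon> > 0 \<and> \<epsilon> * (norm (snd x0))\<^sup>2 < \<theta> / 2 \<and>
        lam * N * C * (exp (2 * (2 * sqrt (M * \<epsilon>))) - 1) < \<theta> / 16) (at_right (0::real))"
      by eventually_elim simp
    then show thesis
      using that eventually_happens'[OF trivial_limit_at_right_real] by blast
  qed
  define \<sigma> where "\<sigma> = 2 * sqrt (M * \<epsilon>)"

  \<comment> \<open>The containment term confines both points to the norm bound \<open>sqrt (4 * M / \<epsilon>)\<close>.\<close>
  obtain \<delta> where \<delta>: "\<delta> > 0"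
    "\<And>x y. x \<in> state_space \<Longrightarrow> y \<in> state_space \<Longrightarrow> norm (snd x) \<le> sqrt (4 * M / \<epsilon>) \<Longrightarrow>
       norm (snd y) \<le> sqrt (4 * M / \<epsilon>) \<Longrightarrow> dist x y < \<delta> \<Longrightarrow> \<bar>h x - h y\<bar> < \<theta> / 16"
  proof -
    define K where "K = {x \<in> state_space :: 'n point set. norm (snd x) \<le> sqrt (4 * M / \<epsilon>)}"
    have "continuous_on K h"
      using h by (auto simp: C_b_def K_def intro: continuous_on_subset)
    then have "uniformly_continuous_on K h"
      unfolding K_def using compact_truncated_state_space by (rule compact_uniformly_continuous)
    moreover have "\<theta> / 16 > 0"
      using \<theta> by simp
    ultimately obtain \<delta> where \<delta>: "\<delta> > 0"
      and unif: "\<forall>y\<in>K. \<forall>x\<in>K. dist x y < \<delta> \<longrightarrow> dist (h x) (h y) < \<theta> / 16"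
      unfolding uniformly_continuous_on_def by blast
    show thesis
    proof (rule that[OF \<delta>])
      fix x y :: "'n point"
      assume "x \<in> state_space" "y \<in> state_space" "norm (snd x) \<le> sqrt (4 * M / \<epsilon>)"
        "norm (snd y) \<le> sqrt (4 * M / \<epsilon>)" "dist x y < \<delta>"
      then show "\<bar>h x - h y\<bar> < \<theta> / 16"
        using unif by (simp only: K_def dist_real_def mem_Collect_eq Ball_def)
    qed
  qed
  define \<beta> where "\<beta> = 32 * M / \<delta>\<^sup>2"
  have \<beta>: "\<beta> > 0"
    using M(1) \<delta>(1) by (simp add: \<beta>_def)
  define B where "B = 2 * sqrt (M * \<beta>)"

  \<comment> \<open>\<open>B\<close> bounds \<open>\<beta> * (w - z)\<close>; it is fixed before \<open>\<alpha>\<close>, which is chosen last, in terms of \<open>\<eta>\<close>.\<close>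
  define S where "S = lam * N * (C * exp (2 * \<sigma>) + exp (B + \<sigma>) + 1)"
  define \<eta> where "\<eta> = \<theta> / (16 * (S + 1))"
  have S: "S \<ge> 0"
    using lam N C by (simp add: S_def)
  have \<eta>: "\<eta> > 0" "\<eta> * S \<le> \<theta> / 16"
    using \<theta> S by (simp_all add: \<eta>_def field_simps)
  obtain \<delta>' where \<delta>': "\<delta>' > 0"
    "\<And>e \<mu> \<nu>. \<mu> \<in> prob_simplex \<Longrightarrow> \<nu> \<in> prob_simplex \<Longrightarrow> dist \<mu> \<nu> < \<delta>' \<Longrightarrow> \<bar>v e \<mu> - v e \<nu>\<bar> \<le> \<eta>"
    "\<And>e \<mu> \<nu>. \<mu> \<in> prob_simplex \<Longrightarrow> \<nu> \<in> prob_simplex \<Longrightarrow> dist \<mu> \<nu> < \<delta>' \<Longrightarrow>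
      \<mu> $ source e < \<nu> $ source e \<Longrightarrow> v e \<mu> \<le> (1 + \<eta>) * v e \<nu>"
    using proper_kernel_modulus[OF kernel \<eta>(1)] by metis
  obtain \<kappa> where \<kappa>: "\<kappa> > 0"
    "\<And>\<mu> \<nu> :: 'n weights. \<mu> \<in> prob_simplex \<Longrightarrow> \<nu> \<in> prob_simplex \<Longrightarrow>
      (\<And>a. flat (\<nu> $ a - \<mu> $ a) < \<kappa>) \<Longrightarrow> dist \<mu> \<nu> < min \<delta>' (\<delta> / 2)"
    using dist_less_if_flat_small[of "min \<delta>' (\<delta> / 2)"] \<delta>(1) \<delta>'(1) by auto
  define \<alpha> where "\<alpha> = 4 * M / \<kappa>"
  have \<alpha>: "\<alpha> > 0"
    using M(1) \<kappa>(1) by (simp add: \<alpha>_def)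

  obtain x y where xy: "x \<in> state_space" "y \<in> state_space"
    and max: "\<And>x' y'. x' \<in> state_space \<Longrightarrow> y' \<in> state_space \<Longrightarrow>
       u x' - u' y' - penalty \<alpha> \<beta> \<epsilon> x' y' \<le> u x - u' y - penalty \<alpha> \<beta> \<epsilon> x y"
  proof (rule penalized_difference_attains_max[of u u' M \<alpha> \<beta> \<epsilon>])
    show "upper_semicontinuous_on state_space u" "lower_semicontinuous_on state_space u'"
      using sub super unfolding viscosity_subsolution_def viscosity_supersolution_def by auto
  qed (use M \<alpha> \<beta> \<epsilon> in auto)
  have simp: "fst x \<in> prob_simplex" "fst y \<in> prob_simplex"
    using xy by (auto simp: state_space_def)

  have "penalty \<alpha> \<beta> \<epsilon> x0 x0 = \<epsilon> * (norm (snd x0))\<^sup>2"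
    by (simp add: penalty_def flat_eq)
  then have gain: "\<theta> / 2 + penalty \<alpha> \<beta> \<epsilon> x y \<le> u x - u' y"
    using max[OF x0 x0] \<epsilon>(2) \<theta>_def by linarith
  then have "penalty \<alpha> \<beta> \<epsilon> x y \<le> 2 * M"
    using M(2)[OF xy(1)] M(3)[OF xy(2)] \<theta> by linarith
  moreover have "0 \<le> \<alpha> * (\<Sum>a\<in>UNIV. flat (fst y $ a - fst x $ a))"
    using \<alpha> by (simp add: sum_nonneg)
  moreover have "0 \<le> \<beta> / 2 * (norm (snd x - snd y))\<^sup>2" "0 \<le> \<epsilon> / 2 * (norm (snd x))\<^sup>2"
    "0 \<le> \<epsilon> / 2 * (norm (snd y))\<^sup>2"
    using \<beta> \<epsilon>(1) by simp_all
  ultimately have pen: "\<alpha> * (\<Sum>a\<in>UNIV. flat (fst y $ a - fst x $ a)) \<le> 2 * M"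
    "\<beta> * (norm (snd x - snd y))\<^sup>2 \<le> 4 * M" "\<epsilon> * (norm (snd x))\<^sup>2 \<le> 4 * M" "\<epsilon> * (norm (snd y))\<^sup>2 \<le> 4 * M"
    unfolding penalty_def distrib_left[of "\<epsilon> / 2"] by linarith+

  \<comment> \<open>The momenta are bounded by the square roots of the penalties they come from: those with factor \<open>\<epsilon>\<close>
      are small, that with factor \<open>\<beta>\<close> is at most \<open>B\<close>.\<close>
  have scaled: "c * norm w \<le> 2 * sqrt (M * c)" if "c > 0" "c * (norm w)\<^sup>2 \<le> 4 * M"
    for c and w :: "(real, 'n edge) vec"
  proof -
    have "(c * norm w)\<^sup>2 = c * (c * (norm w)\<^sup>2)"
      by (simp add: power2_eq_square)
    also have "\<dots> \<le> c * (4 * M)"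
      using that by (intro mult_left_mono) auto
    finally have "c * norm w \<le> sqrt (c * (4 * M))"
      by (rule real_le_rsqrt)
    also have "\<dots> = 2 * sqrt (M * c)"
      by (simp add: real_sqrt_mult)
    finally show ?thesis .
  qed
  have comp: "\<bar>c * w $ e\<bar> \<le> c * norm w" if "c > 0" for c e and w :: "(real, 'n edge) vec"
    using that component_le_norm_cart[of w e] by (simp add: abs_mult)
  have small_x: "\<bar>\<epsilon> * snd x $ e\<bar> \<le> \<sigma>" and small_y: "\<bar>\<epsilon> * snd y $ e\<bar> \<le> \<sigma>"
    and bounded_diff: "\<bar>\<beta> * (snd x - snd y) $ e\<bar> \<le> B" for e
    using comp[OF \<epsilon>(1), of "snd x" e] comp[OF \<epsilon>(1), of "snd y" e] comp[OF \<beta>, of "snd x - snd y" e]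
      scaled[OF \<epsilon>(1) pen(3)] scaled[OF \<epsilon>(1) pen(4)] scaled[OF \<beta> pen(2)]
    unfolding \<sigma>_def B_def by linarith+

  have dist_\<mu>: "dist (fst x) (fst y) < min \<delta>' (\<delta> / 2)"
  proof (rule \<kappa>(2)[OF simp])
    fix a
    have "flat (fst y $ a - fst x $ a) \<le> (\<Sum>a\<in>UNIV. flat (fst y $ a - fst x $ a))"
      by (rule member_le_sum) auto
    also have "\<dots> \<le> \<kappa> / 2"
      using pen(1) M(1) \<kappa>(1) by (simp add: \<alpha>_def field_simps)
    finally show "flat (fst y $ a - fst x $ a) < \<kappa>"
      using \<kappa>(1) by simp
  qed
  have h_diff: "\<bar>h x - h y\<bar> < \<theta> / 16"
  proof (rule \<delta>(2)[OF xy])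
    show "norm (snd x) \<le> sqrt (4 * M / \<epsilon>)" "norm (snd y) \<le> sqrt (4 * M / \<epsilon>)"
      using pen(3,4) \<epsilon>(1) by (intro real_le_rsqrt; simp add: field_simps)+
    have "(norm (snd x - snd y))\<^sup>2 \<le> \<delta>\<^sup>2 / 8"
      using pen(2) M(1) \<delta>(1) by (simp add: \<beta>_def field_simps)
    also have "\<dots> < (\<delta> / 2)\<^sup>2"
      using \<delta>(1) by (simp add: power_divide)
    finally have "norm (snd x - snd y) < \<delta> / 2"
      using \<delta>(1) by (intro power2_less_imp_less[of _ "\<delta> / 2"]) auto
    then show "dist x y < \<delta>"
      using dist_\<mu> dist_prod_def sqrt_sum_squares_le_sum_abs[of "dist (fst x) (fst y)" "dist (snd x) (snd y)"]
      by (simp add: dist_prod_def dist_norm)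
  qed

  define q where "q = (\<lambda>e. \<alpha> * flat' (fst y $ source e - fst x $ source e)
      - \<alpha> * flat' (fst y $ target e - fst x $ target e) + \<beta> * (snd x $ e - snd y $ e))"
  define H1 where "H1 = (\<Sum>e\<in>UNIV. v e (fst x) * (exp (q e + \<epsilon> * snd x $ e) - 1))"
  define H2 where "H2 = (\<Sum>e\<in>UNIV. v e (fst y) * (exp (q e - \<epsilon> * snd y $ e) - 1))"
  have ineq: "u x - h x \<le> lam * H1" "lam * H2 \<le> u' y - h y"
    unfolding H1_def H2_def q_def
    using doubling_inequalities[OF sub super _ _ _ xy max] \<alpha> \<beta> \<epsilon>(1) by auto
  have "lam * H2 \<le> 2 * M"
    using ineq(2) M(3,4)[OF xy(2)] by linarith
  then have "H2 \<le> 2 * M / lam"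
    using lam by (simp add: field_simps)
  then have bound: "v e (fst y) * exp (q e - \<epsilon> * snd y $ e) \<le> C" for e
    unfolding C_def N_def H2_def by (intro hamiltonian_term_bounded[OF simp(2) V(2)[OF simp(2)]])
  have "H1 - H2 = (\<Sum>e\<in>UNIV. v e (fst x) * (exp (q e + \<epsilon> * snd x $ e) - 1)
      - v e (fst y) * (exp (q e - \<epsilon> * snd y $ e) - 1))"
    by (simp add: H1_def H2_def sum_subtractf)
  also have "\<dots> \<le> N * (C * (exp (2 * \<sigma>) - 1) + \<eta> * (C * exp (2 * \<sigma>) + exp (B + \<sigma>) + 1))"
    unfolding N_def
  proof (rule sum_bounded_above, rule exp_flux_difference_le[OF bound _ _ small_x small_y])
    fix e :: "'n edge"
    show "0 \<le> v e (fst y)"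
      using kernel simp(2) unfolding proper_kernel_def by blast
    show "\<bar>v e (fst x) - v e (fst y)\<bar> \<le> \<eta>"
      using \<delta>'(2)[OF simp] dist_\<mu> by simp
    show "q e \<le> B \<or> v e (fst x) \<le> (1 + \<eta>) * v e (fst y)"
    proof (cases "fst x $ source e < fst y $ source e")
      case True
      then show ?thesis
        using \<delta>'(3)[OF simp] dist_\<mu> by simp
    next
      case False
      \<comment> \<open>The source contributes nothing to the exponent, and the target contributes a nonpositive amount.\<close>
      then have "q e \<le> \<beta> * (snd x $ e - snd y $ e)"
        using \<alpha> by (simp add: q_def flat'_nonpos_eq_0)
      then show ?thesis
        using bounded_diff[of e] unfolding vector_minus_component by linarith
    qed
  qed (use \<eta>(1) in simp)
  finally have "lam * (H1 - H2) \<le>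
      lam * (N * (C * (exp (2 * \<sigma>) - 1) + \<eta> * (C * exp (2 * \<sigma>) + exp (B + \<sigma>) + 1)))"
    using lam by simp
  also have "\<dots> = lam * N * C * (exp (2 * \<sigma>) - 1) + \<eta> * S"
    by (simp add: S_def algebra_simps)
  also have "\<dots> \<le> \<theta> / 8"
    using \<epsilon>(3) \<eta>(2) unfolding \<sigma>_def by linarith
  finally have "lam * H1 - lam * H2 \<le> \<theta> / 8"
    by (simp add: right_diff_distrib)
  then have "u x - u' y < \<theta> / 2"
    using ineq h_diff \<theta> by linarith
  then show False
    using gain penalty_nonneg[of \<alpha> \<beta> \<epsilon> x y] \<alpha> \<beta> \<epsilon>(1) by simp
qed

end

theorem theorem3p8:
  fixes v :: "'n::finite edge \<Rightarrow> 'n weights \<Rightarrow> real"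
    and D :: "('n point \<Rightarrow> real) set"
    and H :: "('n point \<Rightarrow> real) \<Rightarrow> ('n point \<Rightarrow> real)"
    and h :: "'n point \<Rightarrow> real"
    and lam :: real
  assumes "proper_kernel v"
    and "C_c_inf \<subseteq> D" and "D \<subseteq> C_b_k 1"
    and "H \<in> D \<rightarrow> C_b"
    and "\<And>f x p. \<lbrakk>f \<in> D; x \<in> state_space; is_gradient f x p\<rbrakk> \<Longrightarrow> H f x = hamiltonian v x p"
    and "lam > 0" and "h \<in> C_b"
  shows "comparison_principle state_space D H lam h"
proof -
  interpret flux_operator v D H h lam
    using assms by unfold_locales auto
  show ?thesis
    unfolding comparison_principle_def using subsolution_le_supersolution by blast
qed

end
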